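(* Let $\mathcal{L}$ satisfy Condition L (defined in the context). Let $n\in\mathbb{N}$, $r\ge 1$, $q\in\left(0,\frac{rn}{(n-r)_+}\right)$ and $\nu:=\frac1q-\frac{n-r}{rn}$. Then for every $\varepsilon>0$ there is a constant $C=C(\varepsilon,n,q,r,\mathcal{L})>0$ such that for every nonnegative $\varphi\in W^{1,r}(\mathbb{R}^n)\setminus\{0\}$ for which $K:=\int_{\mathbb{R}^n}\mathcal{L}(\varphi)$ is finite, $$\|\varphi\|_{L^q(\mathbb{R}^n)}\le C\left(1+(1+K^{\varepsilon})K^{\nu}\right)\|\nabla\varphi\|_{L^r(\mathbb{R}^n)}\,\mathcal{L}^{-\nu}\left(\|\nabla\varphi\|_{L^r(\mathbb{R}^n)}^2\right).$$
   Context: Condition L on a function $\mathcal{L}$: there is $s_0>0$ such that $\mathcal{L}\in C^0([0,\infty))\cap C^1((0,s_0))$ is (real-valued and) positive, bounded and nondecreasing on $(0,\infty)$, and there are $a>0$, $\lambda_0>0$ such that $$\mathcal{L}(s)\le (1+a\lambda)\,\mathcal{L}(s^{1+\lambda})\qquad\text{for all } s\in(0,s_0)\text{ and }\lambda\in(0,\lambda_0).$$ Notation: $\mathcal{L}^{-\nu}(s)$ means $(\mathcal{L}(s))^{-\nu}$; $(n-r)_+=\max\{n-r,0\}$, and $\frac{rn}{(n-r)_+}$ is read as $+\infty$ if $r\ge n$. For $q>0$ (including $q<1$), $\|\varphi\|_{L^q(\mathbb{R}^n)}=\left(\int_{\mathbb{R}^n}|\varphi|^q\right)^{1/q}$. The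 integral $\int_{\mathbb{R}^n}\mathcal{L}(\varphi)$ means $\int_{\mathbb{R}^n}\mathcal{L}(\varphi(x))\,dx$. *)

theory Defs
  imports "HOL-Analysis.Analysis"
begin

text \<open>The function is only meaningful on \<open>[0,\<infinity>)\<close>; its values on negative arguments are irrelevant.\<close>

definition condition_L :: "(real \<Rightarrow> real) \<Rightarrow> bool" where
  "condition_L L \<longleftrightarrow>
     (\<exists>s0>0.
        continuous_on {0..} L \<and> L C1_differentiable_on {0<..<s0} \<and>
        (\<forall>s>0. 0 < L s) \<and> bounded (L ` {0<..}) \<and> mono_on {0<..} L \<and>
        (\<exists>a>0. \<exists>l0>0. \<forall>s\<in>{0<..<s0}. \<forall>l\<in>{0<..<l0}.
            L s \<le> (1 + a * l) * L (s powr (1 + l))))"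

text \<open>Elements of \<open>L\<^sup>q\<close> are represented by measurable functions, so statements about them
  have to be read up to null sets. Since \<open>Lq_norm\<close> is built on the Bochner integral, it is
  meaningful only on \<open>Lq_space\<close>.\<close>

definition Lq_space :: "real \<Rightarrow> (real^'n \<Rightarrow> 'b::euclidean_space) set" where
  "Lq_space q = {f. f \<in> borel_measurable lebesgue \<and>
                    integrable lebesgue (\<lambda>x. norm (f x) powr q)}"

definition Lq_norm :: "real \<Rightarrow> (real^'n \<Rightarrow> 'b::euclidean_space) \<Rightarrow> real" where
  "Lq_norm q f = (LINT x|lebesgue. norm (f x) powr q) powr (1 / q)"

definition partial_deriv :: "'n \<Rightarrow> (real^'n \<Rightarrow> real) \<Rightarrow> real^'n \<Rightarrow> real" where
  "partial_deriv i f x = frechet_derivative f (at x) (axis i 1)"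

primrec C_k :: "nat \<Rightarrow> (real^'n \<Rightarrow> real) \<Rightarrow> bool" where
  "C_k 0 f \<longleftrightarrow> continuous_on UNIV f"
| "C_k (Suc k) f \<longleftrightarrow> (\<forall>x. f differentiable (at x)) \<and> (\<forall>i. C_k k (partial_deriv i f))"

definition test_function :: "(real^'n \<Rightarrow> real) \<Rightarrow> bool" where
  "test_function \<psi> \<longleftrightarrow> (\<forall>k. C_k k \<psi>) \<and> compact (closure {x. \<psi> x \<noteq> 0})"

definition locally_integrable :: "(real^'n \<Rightarrow> 'b::euclidean_space) \<Rightarrow> bool" where
  "locally_integrable f \<longleftrightarrow> (\<forall>S. compact S \<longrightarrow> f absolutely_integrable_on S)"

definition has_weak_gradient :: "(real^'n \<Rightarrow> real) \<Rightarrow> (real^'n \<Rightarrow> real^'n) \<Rightarrow> bool" where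
  "has_weak_gradient u g \<longleftrightarrow>
     locally_integrable u \<and> locally_integrable g \<and>
     (\<forall>\<psi> i. test_function \<psi> \<longrightarrow>
        (LINT x|lebesgue. u x * partial_deriv i \<psi> x) = - (LINT x|lebesgue. g x $ i * \<psi> x))"

definition sobolev_W1 :: "real \<Rightarrow> (real^'n \<Rightarrow> real) set" where
  "sobolev_W1 r = {u. u \<in> Lq_space r \<and> (\<exists>g. has_weak_gradient u g \<and> g \<in> Lq_space r)}"

end

theory Submission
  imports Defs
begin

text \<open>For a test function, the fundamental theorem of calculus along segments and Fubini's theorem
  give, by duality, \<open>\<phi>(x + y) - \<phi>(x) = \<integral>\<^sub>0\<^sup>1 g(x + t y) \<bullet> y dt\<close> for almost every \<open>x\<close> whenever \<open>g\<close> is a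
  weak gradient of \<open>\<phi>\<close>, and therefore \<open>\<parallel>\<phi>(\<cdot> + y) - \<phi>\<parallel>\<^sub>r \<le> |y| G\<close> with \<open>G = \<parallel>\<nabla>\<phi>\<parallel>\<^sub>r\<close>. Let
  \<open>\<mu>(t) = |{\<phi> > t}|\<close>. Averaging over \<open>y\<close> in a cube of volume \<open>2 \<mu>(t)\<close> yields
  \<open>\<mu>(2t) \<le> C (G / t)\<^sup>r \<mu>(t)\<^bsup>r/n\<^esup>\<close>, and iterating this along \<open>t = 2\<^sup>k T\<close> gives a polynomial decay of \<open>\<mu>\<close>
  of order larger than \<open>q\<close>, so no Sobolev embedding is needed. With \<open>V = K / L(s) \<ge> \<mu>(s)\<close> the part
  \<open>{\<phi> > s}\<close> contributes \<open>s V\<^bsup>1/q\<^esup> + G V\<^sup>\<nu>\<close> to \<open>\<parallel>\<phi>\<parallel>\<^sub>q\<close>. Condition L forces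
  \<open>L(s \<tau>) \<ge> c \<tau>\<^sup>\<delta> L(s)\<close> for every \<open>\<delta> > 0\<close>, so \<open>\<phi>\<^sup>q \<le> C s\<^sup>q L(\<phi>) / L(s)\<close> on \<open>{\<phi> \<le> s}\<close>, which
  contributes \<open>s V\<^bsup>1/q\<^esup>\<close> as well. The level \<open>s = min(1, G\<^sup>2) min(1, K\<^bsup>-2/q\<^esup>)\<close> gives the claim.\<close>

section \<open>Smooth bump functions on boxes\<close>

text \<open>All regularity sits on the test functions; the Sobolev function itself is only
  translated and cut at levels. This calls for a rich supply of test functions, built by hand from
  \<open>exp (- 1 / t)\<close>. The resulting fundamental lemma serves twice: for the integral
  identity along segments, and for the uniqueness of weak gradients, since the gradient in the claim
  need not be the one that witnesses membership in the Sobolev space. The decay order is a fixed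
  point: \<mu>(t) ~ t^(-p) is reproduced by \<mu>(2t) \<le> C t^(-r) \<mu>(t)^\<beta> exactly when p
  = r + \<beta> p. As \<open>q\<close> is strictly subcritical, some admissible \<beta> gives p > q,
  and the dyadic layers then sum as a geometric series. A second obstacle is the change of measure:
  the notions are stated over \<open>lebesgue\<close>, while translation and Tonelli are applied to
  Borel functions over \<open>lborel\<close>. Borel representatives mediate, and only the inequality
  between measures of level sets is carried back.\<close>

lemma partial_deriv_eq:
  assumes "(f has_derivative f') (at x)"
  shows "partial_deriv i f x = f' (axis i 1)"
  using frechet_derivative_at[OF assms] by (simp add: partial_deriv_def)

lemma C_k_SucI:
  assumes "\<And>x. (f has_derivative f' x) (at x)" and "\<And>i. C_k k (\<lambda>x. f' x (axis i 1))"
  shows "C_k (Suc k) f"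
proof -
  have "partial_deriv i f = (\<lambda>x. f' x (axis i 1))" for i
    using partial_deriv_eq[OF assms(1)] by blast
  then show ?thesis
    using assms by (auto simp: differentiable_def)
qed

lemma C_k_const: "C_k k (\<lambda>x. c)"
proof (induction k arbitrary: c)
  case (Suc k)
  show ?case
    by (rule C_k_SucI[where f' = "\<lambda>x h. 0"]) (use Suc in auto)
qed simp

text \<open>Serves the product rule: the derivative of a product contains the undifferentiated
  factors, which must count as \<open>C_k k\<close> when they are given as
  \<open>C_k (Suc k)\<close>.\<close>

lemma C_k_SucD: "C_k (Suc k) f \<Longrightarrow> C_k k f"
proof (induction k arbitrary: f)
  case 0
  then show ?case
    by (auto intro!: continuous_at_imp_continuous_on differentiable_imp_continuous_within)
next
  case (Suc k)
  then show ?case by (metis C_k.simps(2))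
qed

lemma C_k_has_derivative:
  assumes "C_k (Suc k) f"
  shows "(f has_derivative frechet_derivative f (at x)) (at x)"
    and "C_k k (\<lambda>x. frechet_derivative f (at x) (axis i 1))"
  using assms by (auto simp: partial_deriv_def[abs_def] frechet_derivative_works)

lemma C_k_add: "C_k k f \<Longrightarrow> C_k k g \<Longrightarrow> C_k k (\<lambda>x. f x + g x)"
proof (induction k arbitrary: f g)
  case (Suc k)
  show ?case
    by (rule C_k_SucI) (auto intro!: has_derivative_add C_k_has_derivative Suc.IH Suc.prems)
qed (auto intro: continuous_intros)

lemma C_k_mult: "C_k k f \<Longrightarrow> C_k k g \<Longrightarrow> C_k k (\<lambda>x. f x * g x)"
proof (induction k arbitrary: f g)
  case (Suc k)
  show ?case
    by (rule C_k_SucI[OF has_derivative_mult])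
       (auto intro!: C_k_has_derivative C_k_add Suc.IH Suc.prems intro: C_k_SucD Suc.prems)
qed (auto intro: continuous_intros)

lemma C_k_prod:
  "finite A \<Longrightarrow> (\<And>a. a \<in> A \<Longrightarrow> C_k k (f a)) \<Longrightarrow> C_k k (\<lambda>x. \<Prod>a\<in>A. f a x)"
  by (induction A rule: finite_induct) (auto intro: C_k_const C_k_mult)

lemma C_k_shift: "C_k k f \<Longrightarrow> C_k k (\<lambda>x. f (x - z))"
proof (induction k arbitrary: f)
  case 0
  then show ?case by (auto intro!: continuous_intros elim: continuous_on_subset intro: continuous_on_compose2)
next
  case (Suc k)
  show ?case
  proof (rule C_k_SucI)
    fix x
    show "((\<lambda>x. f (x - z)) has_derivative (\<lambda>h. frechet_derivative f (at (x - z)) h)) (at x)"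
      by (rule has_derivative_compose[where f = "\<lambda>x. x - z", simplified])
         (auto intro!: derivative_eq_intros C_k_has_derivative Suc.prems)
    show "C_k k (\<lambda>x. frechet_derivative f (at (x - z)) (axis i 1))" for i
      by (rule Suc.IH) (rule C_k_has_derivative(2)[OF Suc.prems])
  qed
qed

text \<open>The functions \<open>P(1/t) exp(-1/t)\<close>, extended by zero, form a class closed under differentiation.\<close>

definition flat :: "real poly \<Rightarrow> real \<Rightarrow> real" where
  "flat P t = (if 0 < t then poly P (1 / t) * exp (- 1 / t) else 0)"

text \<open>With y = 1/t one has d/dt = -y^2 d/dy, and the derivative of P(y) e^(-y) in y is (P' -
  P)(y) e^(-y).\<close>

definition flat_step :: "real poly \<Rightarrow> real poly" where
  "flat_step P = monom 1 2 * (P - pderiv P)"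

text \<open>The free power \<open>y ^ k\<close> makes the induction go through: splitting off the
  constant coefficient leaves a factor y, which is moved into the power.\<close>

lemma poly_times_exp_minus_at_top:
  "((\<lambda>y. y ^ k * poly P y * exp (- y)) \<longlongrightarrow> (0::real)) at_top"
proof (induction P arbitrary: k rule: pCons_induct)
  case (pCons a P)
  have "((\<lambda>y. a * (y ^ k / exp y) + y ^ Suc k * poly P y * exp (- y)) \<longlongrightarrow> a * 0 + 0) at_top"
    by (intro tendsto_intros tendsto_power_div_exp_0 pCons.IH)
  then show ?case
    by (simp add: algebra_simps exp_minus field_simps)
qed simp

lemma flat_has_derivative: "(flat P has_real_derivative flat (flat_step P) t) (at t)"
proof -
  consider "t < 0" | "0 < t" | "t = 0" by linarith
  then show ?thesis
  proof cases
    case 1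
    have "((\<lambda>t. 0) has_real_derivative flat (flat_step P) t) (at t)"
      using 1 by (simp add: flat_def)
    then show ?thesis
      by (rule has_field_derivative_transform_within_open[where S = "{..<0}"]) (use 1 in \<open>auto simp: flat_def\<close>)
  next
    case 2
    have "((\<lambda>t. poly P (1 / t) * exp (- 1 / t)) has_real_derivative flat (flat_step P) t) (at t)"
      using 2 by (auto intro!: derivative_eq_intros poly_DERIV[THEN DERIV_chain2]
          simp: flat_def flat_step_def poly_monom field_simps power2_eq_square)
    then show ?thesis
      by (rule has_field_derivative_transform_within_open[where S = "{0<..}"]) (use 2 in \<open>auto simp: flat_def\<close>)
  next
    case 3
    \<comment> \<open>For h > 0 and y = 1/h, the difference quotient at 0 is y P(y) e^(-y): the
      decay lemma with exponent 1.\<close>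
    have "((\<lambda>h. (inverse h) ^ 1 * poly P (inverse h) * exp (- inverse h)) \<longlongrightarrow> (0::real)) (at_right 0)"
      by (rule filterlim_compose[OF poly_times_exp_minus_at_top filterlim_inverse_at_top_right])
    then have "((\<lambda>h. flat P h / h) \<longlongrightarrow> 0) (at_right 0)"
      by (rule Lim_transform_eventually)
         (auto simp: flat_def eventually_at_right_field field_simps intro!: exI[of _ 1])
    moreover have "((\<lambda>h. flat P h / h) \<longlongrightarrow> 0) (at_left 0)"
      by (rule Lim_transform_eventually[OF tendsto_const])
         (auto simp: flat_def eventually_at_left_field intro!: exI[of _ "-1"])
    ultimately have "((\<lambda>h. flat P h / h) \<longlongrightarrow> 0) (at 0)"
      by (simp add: filterlim_at_split)
    moreover have "flat P 0 = 0" "flat (flat_step P) 0 = 0"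
      by (simp_all add: flat_def)
    ultimately show ?thesis
      using 3 by (simp add: DERIV_def)
  qed
qed

lemma C_k_flat_coord: "C_k k (\<lambda>x. flat P (c * x $ i + d))"
proof (induction k arbitrary: P)
  case 0
  have "continuous_on UNIV (flat P)"
    using flat_has_derivative by (meson DERIV_continuous_on)
  then show ?case
    by (auto intro!: continuous_intros elim: continuous_on_compose2)
next
  case (Suc k)
  show ?case
  proof (rule C_k_SucI)
    fix x
    show "((\<lambda>x. flat P (c * x $ i + d)) has_derivative
            (\<lambda>h. flat (flat_step P) (c * x $ i + d) * (c * h $ i))) (at x)"
      by (rule has_derivative_compose[OF _ flat_has_derivative[unfolded has_field_derivative_def]])
         (auto intro!: derivative_eq_intros bounded_linear.has_derivative[OF bounded_linear_vec_nth])
    show "C_k k (\<lambda>x. flat (flat_step P) (c * x $ i + d) * (c * axis j 1 $ i))" for j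
      by (intro C_k_mult Suc.IH C_k_const)
  qed
qed

text \<open>Coordinate i contributes exp(-1/(c u)) for the distances u of \<open>x $ i\<close> from
  both ends of its interval. The parameter \<open>c\<close> sharpens the bump; the affine arguments
  are spelled out to match \<open>C_k_flat_coord\<close>.\<close>

definition box_bump :: "real \<Rightarrow> real^'n \<Rightarrow> real^'n \<Rightarrow> real^'n \<Rightarrow> real" where
  "box_bump c a b x = (\<Prod>i\<in>UNIV. flat 1 (c * x $ i + - c * a $ i) * flat 1 ((- c) * x $ i + c * b $ i))"

lemma flat_1: "flat 1 t = (if 0 < t then exp (- 1 / t) else 0)"
  by (simp add: flat_def)

lemma box_bump_bounds: "0 \<le> box_bump c a b x" "box_bump c a b x \<le> 1"
  unfolding box_bump_def
  by (auto intro!: prod_nonneg prod_le_1 mult_nonneg_nonneg mult_le_one simp: flat_1)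

lemma box_bump_outside:
  assumes "0 < c" "x \<notin> box a b"
  shows "box_bump c a b x = 0"
proof -
  obtain i where "x $ i \<le> a $ i \<or> b $ i \<le> x $ i"
    using assms(2) by (auto simp: mem_box_cart not_less)
  then show ?thesis
    unfolding box_bump_def using assms(1) by (intro prod_zero bexI[of _ i]) (auto simp: flat_1 not_less)
qed

lemma test_function_box_bump:
  assumes "0 < c"
  shows "test_function (box_bump c a b)"
  unfolding test_function_def
proof
  show "\<forall>k. C_k k (box_bump c a b)"
    unfolding box_bump_def[abs_def] by (intro allI C_k_prod C_k_mult C_k_flat_coord) simp
  have "{x. box_bump c a b x \<noteq> 0} \<subseteq> box a b"
    using box_bump_outside[OF assms] by blast
  then show "compact (closure {x. box_bump c a b x \<noteq> 0})"
    by (meson bounded_box bounded_subset compact_closure)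
qed

text \<open>Inside the open box every factor is exp(-1/((k+1) u)) with u > 0 and tends to 1;
  outside, some factor vanishes for every k. Hence the limit holds at every point, the boundary
  included.\<close>

lemma box_bump_tendsto:
  "(\<lambda>k. box_bump (real (Suc k)) a b x) \<longlonglongrightarrow> indicator (box a b) x"
proof (cases "x \<in> box a b")
  case False
  then show ?thesis by (simp add: box_bump_outside)
next
  case True
  have *: "(\<lambda>k. flat 1 (real (Suc k) * u)) \<longlonglongrightarrow> 1" if "0 < u" for u
  proof -
    have "(\<lambda>k. exp (- (inverse u * inverse (real (Suc k))))) \<longlonglongrightarrow> exp (- (inverse u * 0))"
      by (intro tendsto_intros LIMSEQ_inverse_real_of_nat)
    moreover have "flat 1 (real (Suc k) * u) = exp (- (inverse u * inverse (real (Suc k))))" for k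
      using that by (simp add: flat_1 field_simps add_pos_nonneg)
    ultimately show ?thesis by simp
  qed
  have "(\<lambda>k. \<Prod>i\<in>UNIV. flat 1 (real (Suc k) * (x $ i - a $ i)) * flat 1 (real (Suc k) * (b $ i - x $ i)))
     \<longlonglongrightarrow> (\<Prod>i\<in>(UNIV :: 'a set). 1 * 1)"
    by (intro tendsto_prod tendsto_mult *) (use True in \<open>auto simp: mem_box_cart\<close>)
  then show ?thesis
    using True by (simp add: box_bump_def algebra_simps)
qed

lemma test_function_shift:
  assumes "test_function \<psi>"
  shows "test_function (\<lambda>x. \<psi> (x - z))"
proof -
  have "{x. \<psi> (x - z) \<noteq> 0} = (+) z ` {x. \<psi> x \<noteq> 0}"
    by (force simp: image_iff)
  then show ?thesis
    using assms unfolding test_function_def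
    by (auto simp: closure_translation compact_translation C_k_shift)
qed

section \<open>The fundamental lemma of the calculus of variations\<close>

text \<open>The Borel counterpart of \<open>locally_integrable\<close>, over \<open>lborel\<close>,
  where Fubini's theorem and translation invariance are applied. Balls around 0 are enough, since
  every compact set lies in one.\<close>

definition loc_int :: "('a::euclidean_space \<Rightarrow> 'b::euclidean_space) \<Rightarrow> bool" where
  "loc_int f \<longleftrightarrow> f \<in> borel_measurable borel \<and> (\<forall>R. set_integrable lborel (cball 0 R) f)"

lemma loc_int_measurable: "loc_int f \<Longrightarrow> f \<in> borel_measurable borel"
  by (simp add: loc_int_def)

text \<open>Boundedness and compact support of the multiplier are packed into one inequality, which
  fits indicators of balls and boxes as well as test functions.\<close>

lemma loc_int_mult_integrable:
  fixes f h :: "'a::euclidean_space \<Rightarrow> real"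
  assumes "loc_int f" "h \<in> borel_measurable borel" "\<And>x. \<bar>h x\<bar> \<le> M * indicator (cball 0 R) x"
  shows "integrable lborel (\<lambda>x. f x * h x)"
proof (rule Bochner_Integration.integrable_bound)
  show "integrable lborel (\<lambda>x. M * (indicator (cball 0 R) x *\<^sub>R f x))"
    using assms(1) by (auto simp: loc_int_def set_integrable_def)
  show "(\<lambda>x. f x * h x) \<in> borel_measurable lborel"
    using assms by (auto simp: loc_int_def)
  have "\<bar>f x\<bar> * \<bar>h x\<bar> \<le> \<bar>f x\<bar> * (\<bar>M\<bar> * indicator (cball 0 R) x)" for x
    by (rule mult_left_mono[OF order_trans[OF assms(3)]]) (auto intro!: mult_right_mono)
  then show "AE x in lborel. norm (f x * h x) \<le> norm (M * (indicator (cball 0 R) x *\<^sub>R f x))"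
    by (simp add: abs_mult mult_ac)
qed

text \<open>After cutting \<open>f\<close> off to \<open>B N\<close> it is integrable, so the Borel
  sets over which its integral vanishes form a Dynkin system. The system contains the open boxes,
  which generate the Borel sets and are stable under intersection.\<close>

lemma integral_zero_on_boxes_imp_AE_zero:
  fixes f :: "'a::euclidean_space \<Rightarrow> real"
  assumes f: "loc_int f" and zero: "\<And>a b. (LINT x:box a b|lborel. f x) = 0"
  shows "AE x in lborel. f x = 0"
proof -
  define B :: "nat \<Rightarrow> 'a set" where "B N = box (- (real N *\<^sub>R One)) (real N *\<^sub>R One)" for N
  have int_B: "integrable lborel (\<lambda>x. f x * indicator (B N) x)" for N
  proof -
    obtain R where "B N \<subseteq> cball 0 R"
      using bounded_subset_ballD[of "B N" 0] ball_subset_cball by (fastforce simp: B_def)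
    then show ?thesis
      by (intro loc_int_mult_integrable[OF f, where M = 1 and R = R]) (auto simp: indicator_def B_def)
  qed
  have "AE x in lborel. f x * indicator (B N) x = 0" for N
  proof (rule sigma_finite_measure.density_zero[OF sigma_finite_lborel int_B])
    fix A :: "'a set" assume "A \<in> sets lborel"
    then have A: "A \<in> sigma_sets UNIV (range (\<lambda>(a, b). box a b))"
      by (simp add: borel_eq_box)
    have "Int_stable (range (\<lambda>(a, b). box a b :: 'a set))"
      by (auto simp: Int_stable_def box_Int_box)
    moreover have "range (\<lambda>(a, b). box a b :: 'a set) \<subseteq> Pow UNIV" by simp
    ultimately show "(LINT x:A|lborel. f x * indicator (B N) x) = 0"
      using A
    proof (induction rule: sigma_sets_induct_disjoint)
      case (basic A)
      then obtain a b where "A \<inter> B N = box a b"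
        unfolding B_def by (auto simp: box_Int_box)
      then have "(LINT x:A|lborel. f x * indicator (B N) x) = (LINT x:box a b|lborel. f x)"
        unfolding set_lebesgue_integral_def by (metis (no_types, lifting) indicator_inter_arith mult.commute mult.left_commute real_scaleR_def)
      then show ?case using zero by simp
    next
      case (compl A)
      then have A: "A \<in> sets lborel" by (simp add: borel_eq_box)
      have "set_integrable lborel A (\<lambda>x. f x * indicator (B N) x)"
        unfolding set_integrable_def using A int_B by (rule integrable_mult_indicator)
      moreover have "set_integrable lborel (UNIV - A) (\<lambda>x. f x * indicator (B N) x)"
        unfolding set_integrable_def using A int_B by (intro integrable_mult_indicator) auto
      ultimately have "(LINT x:A \<union> (UNIV - A)|lborel. f x * indicator (B N) x)
        = (LINT x:A|lborel. f x * indicator (B N) x) + (LINT x:UNIV - A|lborel. f x * indicator (B N) x)"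
        by (intro set_integral_Un) auto
      moreover have "(LINT x:A \<union> (UNIV - A)|lborel. f x * indicator (B N) x) = 0"
        using zero[of "- (real N *\<^sub>R One)" "real N *\<^sub>R One"]
        by (simp add: set_lebesgue_integral_def B_def mult.commute)
      ultimately show ?case using compl by simp
    next
      case (union A)
      then have A: "A i \<in> sets lborel" for i by (auto simp: borel_eq_box)
      have "(LINT x:(\<Union>i. A i)|lborel. f x * indicator (B N) x) = (\<Sum>i. LINT x:A i|lborel. f x * indicator (B N) x)"
      proof (rule lebesgue_integral_countable_add)
        show "set_integrable lborel (\<Union>i. A i) (\<lambda>x. f x * indicator (B N) x)"
          unfolding set_integrable_def by (intro integrable_mult_indicator int_B sets.countable_UN) (use A in auto)
      qed (use A union(1) in \<open>auto simp: disjoint_family_on_def\<close>)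
      then show ?case using union by simp
    qed (simp add: set_lebesgue_integral_def)
  qed
  then have "AE x in lborel. \<forall>N. f x * indicator (B N) x = 0"
    by (subst AE_all_countable) blast
  moreover have "\<exists>N. x \<in> B N" for x :: 'a
    using UN_box_eq_UNIV[where 'a = 'a] by (auto simp: B_def)
  ultimately show ?thesis
    by (elim AE_mp) (auto intro!: AE_I2, metis indicator_simps(1) mult_cancel_left1 mult_eq_0_iff)
qed

text \<open>Bumps lie between 0 and the indicator of their box, so dominated convergence passes from
  bumps to boxes.\<close>

lemma integral_zero_on_test_functions_imp_AE_zero:
  fixes f :: "real^'n \<Rightarrow> real"
  assumes f: "loc_int f" and zero: "\<And>\<psi>. test_function \<psi> \<Longrightarrow> (LINT x|lborel. f x * \<psi> x) = 0"
  shows "AE x in lborel. f x = 0"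
proof (rule integral_zero_on_boxes_imp_AE_zero[OF f])
  fix a b :: "real^'n"
  note [measurable] = loc_int_measurable[OF f]
  have [measurable]: "box_bump c a b \<in> borel_measurable borel" for c
  proof -
    have "C_k 0 (box_bump c a b)"
      unfolding box_bump_def[abs_def] by (intro C_k_prod C_k_mult C_k_flat_coord) simp
    then show ?thesis by (simp add: borel_measurable_continuous_onI)
  qed
  obtain R where R: "box a b \<subseteq> cball 0 R"
    using bounded_subset_ballD[of "box a b" 0] ball_subset_cball by fastforce
  have "(\<lambda>k. LINT x|lborel. f x * box_bump (real (Suc k)) a b x) \<longlonglongrightarrow> (LINT x|lborel. f x * indicator (box a b) x)"
  proof (rule integral_dominated_convergence)
    show "integrable lborel (\<lambda>x. norm (f x * indicator (box a b) x))"
      using R by (intro integrable_norm loc_int_mult_integrable[OF f, where M = 1 and R = R]) (auto simp: indicator_def)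
    show "AE x in lborel. norm (f x * box_bump (real (Suc k)) a b x) \<le> norm (f x * indicator (box a b) x)" for k
      by (intro AE_I2) (auto simp: abs_mult indicator_def box_bump_outside box_bump_bounds intro!: mult_left_le)
  qed (auto intro!: AE_I2 tendsto_intros box_bump_tendsto simp del: of_nat_Suc)
  moreover have "(LINT x|lborel. f x * box_bump (real (Suc k)) a b x) = 0" for k
    by (intro zero test_function_box_bump) simp
  ultimately have "(LINT x|lborel. f x * indicator (box a b) x) = 0"
    by (simp add: LIMSEQ_const_iff)
  then show "(LINT x:box a b|lborel. f x) = 0"
    by (simp add: set_lebesgue_integral_def mult.commute)
qed

lemma test_function_continuous: "test_function \<psi> \<Longrightarrow> continuous_on UNIV \<psi>"
  unfolding test_function_def using C_k.simps(1) by blast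

lemma test_function_has_derivative:
  "test_function \<psi> \<Longrightarrow> (\<psi> has_derivative frechet_derivative \<psi> (at x)) (at x)"
  unfolding test_function_def using C_k_has_derivative(1) by blast

lemma test_function_bound:
  assumes "test_function \<psi>"
  obtains M R where "\<And>x. \<bar>\<psi> x\<bar> \<le> M * indicator (cball 0 R) x"
proof -
  let ?S = "closure {x. \<psi> x \<noteq> 0}"
  have S: "compact ?S" using assms by (simp add: test_function_def)
  then have "compact (\<psi> ` ?S)"
    using test_function_continuous[OF assms] by (intro compact_continuous_image) (auto intro: continuous_on_subset)
  then obtain M where M: "\<And>x. x \<in> ?S \<Longrightarrow> \<bar>\<psi> x\<bar> \<le> M"
    by (force dest!: compact_imp_bounded simp: bounded_iff)
  obtain R where R: "?S \<subseteq> cball 0 R"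
    using bounded_subset_ballD[OF compact_imp_bounded[OF S], of 0] ball_subset_cball by fastforce
  have "\<bar>\<psi> x\<bar> \<le> max M 0 * indicator (cball 0 R) x" for x
  proof (cases "\<psi> x = 0")
    case False
    then have "x \<in> ?S" using closure_subset by fastforce
    then show ?thesis using M[of x] R by (auto simp: indicator_def)
  qed (auto simp: indicator_def)
  then show ?thesis using that by blast
qed

lemma test_function_partial_deriv:
  assumes "test_function \<psi>"
  shows "test_function (partial_deriv i \<psi>)"
proof -
  have "partial_deriv i \<psi> x = 0" if "x \<notin> closure {x. \<psi> x \<noteq> 0}" for x
  proof -
    have "((\<lambda>x. 0) has_derivative (\<lambda>x. 0)) (at x)" by simp
    then have "(\<psi> has_derivative (\<lambda>x. 0)) (at x)"
      by (rule has_derivative_transform_within_open[OF _ open_Compl[OF closed_closure[of "{x. \<psi> x \<noteq> 0}"]]])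
         (use that closure_subset[of "{x. \<psi> x \<noteq> 0}"] in auto)
    then show ?thesis by (simp add: partial_deriv_eq)
  qed
  then have "closure {x. partial_deriv i \<psi> x \<noteq> 0} \<subseteq> closure {x. \<psi> x \<noteq> 0}"
    by (intro closure_minimal) auto
  then show ?thesis
    using assms unfolding test_function_def
    by (metis C_k.simps(2) closed_closure inf.absorb_iff2 compact_Int_closed)
qed

lemma frechet_derivative_test_function:
  assumes "test_function \<psi>"
  shows "frechet_derivative \<psi> (at x) y = (\<Sum>i\<in>UNIV. y $ i * partial_deriv i \<psi> x)"
proof -
  interpret linear "frechet_derivative \<psi> (at x)"
    using test_function_has_derivative[OF assms] by (rule has_derivative_linear)
  have "frechet_derivative \<psi> (at x) y = frechet_derivative \<psi> (at x) (\<Sum>i\<in>UNIV. y $ i *\<^sub>R axis i 1)"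
    by (subst basis_expansion[of y, unfolded scalar_mult_eq_scaleR, symmetric]) simp
  then show ?thesis by (simp add: sum scale partial_deriv_def)
qed

section \<open>Translation estimate for weak gradients\<close>

lemma lborel_integral_shift:
  fixes f :: "'a::euclidean_space \<Rightarrow> 'b::{banach, second_countable_topology}"
  assumes "f \<in> borel_measurable borel"
  shows "(LINT x|lborel. f (c + x)) = (LINT x|lborel. f x)"
  using integral_distr[of "(+) c" lborel borel f] assms by (simp add: lborel_distr_plus)

lemma lborel_nn_integral_shift:
  fixes f :: "'a::euclidean_space \<Rightarrow> ennreal"
  assumes "f \<in> borel_measurable borel"
  shows "(\<integral>\<^sup>+x. f (c + x) \<partial>lborel) = (\<integral>\<^sup>+x. f x \<partial>lborel)"
  using nn_integral_distr[of "(+) c" lborel borel f] assms by (simp add: lborel_distr_plus)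

lemma lborel_integrable_shift:
  fixes f :: "'a::euclidean_space \<Rightarrow> 'b::{banach, second_countable_topology}"
  assumes "integrable lborel f"
  shows "integrable lborel (\<lambda>x. f (c + x))"
  using integrable_distr[of "(+) c" lborel borel f] assms by (simp add: lborel_distr_plus)

lemma loc_int_shift:
  assumes "loc_int f"
  shows "loc_int (\<lambda>x. f (c + x))"
  unfolding loc_int_def
proof (intro conjI allI)
  note [measurable] = loc_int_measurable[OF assms]
  show "(\<lambda>x. f (c + x)) \<in> borel_measurable borel" by measurable
  fix R
  have "integrable lborel (\<lambda>x. indicator (cball 0 (R + norm c)) (c + x) *\<^sub>R f (c + x))"
    using assms unfolding loc_int_def set_integrable_def by (intro lborel_integrable_shift) auto
  then show "set_integrable lborel (cball 0 R) (\<lambda>x. f (c + x))"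
    unfolding set_integrable_def
  proof (rule Bochner_Integration.integrable_bound)
    have "norm (c + x) \<le> R + norm c" if "norm x \<le> R" for x
      using norm_triangle_ineq[of c x] that by simp
    then show "AE x in lborel. norm (indicat_real (cball 0 R) x *\<^sub>R f (c + x))
       \<le> norm (indicat_real (cball 0 (R + norm c)) (c + x) *\<^sub>R f (c + x))"
      by (intro AE_I2) (auto simp: indicator_def)
  next
    have [measurable]: "cball 0 R \<in> sets (borel :: 'a measure)" by simp
    show "(\<lambda>x. indicator (cball 0 R) x *\<^sub>R f (c + x)) \<in> borel_measurable lborel" by measurable
  qed
qed

lemma loc_int_inner:
  assumes "loc_int g"
  shows "loc_int (\<lambda>x. g x \<bullet> y)"
  using assms unfolding loc_int_def set_integrable_def
  by (auto simp flip: inner_scaleR_left)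

lemma loc_int_diff:
  assumes "loc_int f" "loc_int g"
  shows "loc_int (\<lambda>x. f x - g x)"
  using assms unfolding loc_int_def set_integrable_def
  by (auto simp: scaleR_diff_right)

text \<open>Supplies the absolute integrability for both uses of Fubini's theorem. For t in [0,1]
  all translates of \<theta> live in the ball of radius R + |y|, which gives a bound uniform in t;
  the second form becomes the first after translating x by t y.\<close>

lemma integrable_segment_product:
  fixes f \<theta> :: "'a::euclidean_space \<Rightarrow> real"
  assumes f: "loc_int f" and \<theta>: "\<theta> \<in> borel_measurable borel" "\<And>x. \<bar>\<theta> x\<bar> \<le> M * indicator (cball 0 R) x"
  shows "integrable (lborel \<Otimes>\<^sub>M lborel) (\<lambda>(x, t). indicator {0..1::real} t * (f x * \<theta> (x - t *\<^sub>R y)))"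
    and "integrable (lborel \<Otimes>\<^sub>M lborel) (\<lambda>(x, t). indicator {0..1::real} t * (f (x + t *\<^sub>R y) * \<theta> x))"
proof -
  note [measurable] = loc_int_measurable[OF f] \<theta>(1)
  define S where "S = R + norm y"
  define I where "I = (LINT x|lborel. \<bar>f x\<bar> * (\<bar>M\<bar> * indicator (cball 0 S) x))"
  have "(\<lambda>x. \<bar>M\<bar> * indicator (cball 0 S) x) \<in> borel_measurable (borel :: 'a measure)"
    by (intro borel_measurable_times borel_measurable_const borel_measurable_indicator borel_closed closed_cball)
  from integrable_abs[OF loc_int_mult_integrable[OF f this, of "\<bar>M\<bar>" S]]
  have int: "integrable lborel (\<lambda>x. \<bar>f x\<bar> * (\<bar>M\<bar> * indicator (cball 0 S) x))"
    by (simp add: abs_mult)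
  have *: "(\<integral>\<^sup>+x. ennreal \<bar>indicator {0..1} t * (f x * \<theta> (x - t *\<^sub>R y))\<bar> \<partial>lborel) \<le> ennreal I * indicator {0..1} t" for t
  proof (cases "t \<in> {0..1}")
    case True
    have "\<bar>\<theta> (x - t *\<^sub>R y)\<bar> \<le> \<bar>M\<bar> * indicator (cball 0 S) x" for x
    proof -
      have "norm x \<le> S" if "norm (x - t *\<^sub>R y) \<le> R"
      proof -
        have "norm x \<le> norm (x - t *\<^sub>R y) + \<bar>t\<bar> * norm y"
          using norm_triangle_ineq[of "x - t *\<^sub>R y" "t *\<^sub>R y"] by simp
        moreover have "\<bar>t\<bar> * norm y \<le> norm y" using True by (simp add: mult_left_le_one_le)
        ultimately show ?thesis using that by (simp add: S_def)
      qed
      moreover have "\<bar>\<theta> (x - t *\<^sub>R y)\<bar> \<le> \<bar>M\<bar> * indicator (cball 0 R) (x - t *\<^sub>R y)"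
        by (rule order_trans[OF \<theta>(2)]) (auto intro!: mult_right_mono)
      ultimately show ?thesis
        by (cases "norm (x - t *\<^sub>R y) \<le> R") (auto simp: indicator_def)
    qed
    then have "(\<integral>\<^sup>+x. ennreal \<bar>indicator {0..1} t * (f x * \<theta> (x - t *\<^sub>R y))\<bar> \<partial>lborel)
      \<le> (\<integral>\<^sup>+x. ennreal (\<bar>f x\<bar> * (\<bar>M\<bar> * indicator (cball 0 S) x)) \<partial>lborel)"
      using True by (intro nn_integral_mono ennreal_leI) (simp add: abs_mult mult_left_mono)
    also have "\<dots> = I"
      unfolding I_def by (rule nn_integral_eq_integral[OF int]) simp
    finally show ?thesis using True by simp
  qed simp
  have fin: "(\<integral>\<^sup>+t. ennreal I * indicator {0..1::real} t \<partial>lborel) < \<infinity>"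
    by (subst nn_integral_cmult_indicator) (auto simp: ennreal_mult_less_top)
  show int1: "integrable (lborel \<Otimes>\<^sub>M lborel) (\<lambda>(x, t). indicator {0..1::real} t * (f x * \<theta> (x - t *\<^sub>R y)))"
  proof (rule integrableI_bounded)
    have "(\<integral>\<^sup>+ z. norm (case z of (x, t) \<Rightarrow> indicat_real {0..1} t * (f x * \<theta> (x - t *\<^sub>R y))) \<partial>(lborel \<Otimes>\<^sub>M lborel))
      = (\<integral>\<^sup>+t. \<integral>\<^sup>+x. ennreal \<bar>indicator {0..1} t * (f x * \<theta> (x - t *\<^sub>R y))\<bar> \<partial>lborel \<partial>lborel)"
      by (subst lborel_pair.nn_integral_snd[symmetric]) auto
    also have "\<dots> \<le> (\<integral>\<^sup>+t. ennreal I * indicator {0..1::real} t \<partial>lborel)"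
      by (rule nn_integral_mono) (rule *)
    also note fin
    finally show "(\<integral>\<^sup>+ z. norm (case z of (x, t) \<Rightarrow> indicat_real {0..1} t * (f x * \<theta> (x - t *\<^sub>R y))) \<partial>(lborel \<Otimes>\<^sub>M lborel)) < \<infinity>" .
  qed measurable
  show "integrable (lborel \<Otimes>\<^sub>M lborel) (\<lambda>(x, t). indicator {0..1::real} t * (f (x + t *\<^sub>R y) * \<theta> x))"
  proof (rule integrableI_bounded)
    have "(\<integral>\<^sup>+ z. norm (case z of (x, t) \<Rightarrow> indicat_real {0..1} t * (f (x + t *\<^sub>R y) * \<theta> x)) \<partial>(lborel \<Otimes>\<^sub>M lborel))
      = (\<integral>\<^sup>+t. \<integral>\<^sup>+x. ennreal \<bar>indicator {0..1} t * (f (x + t *\<^sub>R y) * \<theta> x)\<bar> \<partial>lborel \<partial>lborel)"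
      by (subst lborel_pair.nn_integral_snd[symmetric]) auto
    also have "\<dots> = (\<integral>\<^sup>+t. \<integral>\<^sup>+x. ennreal \<bar>indicator {0..1} t * (f x * \<theta> (x - t *\<^sub>R y))\<bar> \<partial>lborel \<partial>lborel)"
    proof (rule nn_integral_cong)
      fix t :: real
      show "(\<integral>\<^sup>+x. ennreal \<bar>indicator {0..1} t * (f (x + t *\<^sub>R y) * \<theta> x)\<bar> \<partial>lborel)
        = (\<integral>\<^sup>+x. ennreal \<bar>indicator {0..1} t * (f x * \<theta> (x - t *\<^sub>R y))\<bar> \<partial>lborel)"
        using lborel_nn_integral_shift[of "\<lambda>x. ennreal \<bar>indicator {0..1} t * (f x * \<theta> (x - t *\<^sub>R y))\<bar>" "t *\<^sub>R y"]
        by (simp add: add.commute)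
    qed
    also have "\<dots> \<le> (\<integral>\<^sup>+t. ennreal I * indicator {0..1::real} t \<partial>lborel)"
      by (rule nn_integral_mono) (rule *)
    also note fin
    finally show "(\<integral>\<^sup>+ z. norm (case z of (x, t) \<Rightarrow> indicat_real {0..1} t * (f (x + t *\<^sub>R y) * \<theta> x)) \<partial>(lborel \<Otimes>\<^sub>M lborel)) < \<infinity>" .
  qed measurable
qed

text \<open>The segment runs in direction -y because translating \<phi> by y amounts, under the
  integral, to translating the test function by -y.\<close>

lemma test_function_segment:
  assumes "test_function \<psi>"
  shows "\<psi> (x - y) - \<psi> x =
    - (LINT t|lborel. indicator {0..1} t * (\<Sum>i\<in>UNIV. y $ i * partial_deriv i \<psi> (x - t *\<^sub>R y)))"
proof -
  let ?D = "\<lambda>t. \<Sum>i\<in>UNIV. y $ i * partial_deriv i \<psi> (x - t *\<^sub>R y)"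
  have "((\<lambda>t. - \<psi> (x - t *\<^sub>R y)) has_vector_derivative ?D t) (at t within {0..1})" for t
  proof -
    have "((\<lambda>t. x - t *\<^sub>R y) has_derivative (\<lambda>h. - h *\<^sub>R y)) (at t)"
      by (auto intro!: derivative_eq_intros)
    from has_derivative_compose[OF this test_function_has_derivative[OF assms]]
    have "((\<lambda>t. \<psi> (x - t *\<^sub>R y)) has_derivative (\<lambda>h. frechet_derivative \<psi> (at (x - t *\<^sub>R y)) (- h *\<^sub>R y))) (at t)" .
    then have "((\<lambda>t. - \<psi> (x - t *\<^sub>R y)) has_derivative (\<lambda>h. h *\<^sub>R ?D t)) (at t)"
      by (intro derivative_eq_intros | assumption)+
         (simp add: frechet_derivative_test_function[OF assms] sum_distrib_left sum_negf mult_ac fun_eq_iff)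
    then show ?thesis
      by (simp add: has_vector_derivative_def has_derivative_at_withinI)
  qed
  moreover have "continuous_on {0..1} ?D"
    by (intro continuous_intros continuous_on_compose2[OF test_function_continuous[OF test_function_partial_deriv[OF assms]]]) auto
  ultimately have "(LINT t|lborel. indicator {0..1} t *\<^sub>R ?D t) = - \<psi> (x - 1 *\<^sub>R y) - (- \<psi> (x - 0 *\<^sub>R y))"
    by (intro integral_FTC_Icc) auto
  then show ?thesis by simp
qed

text \<open>Both sides are tested against an arbitrary test function, for which the identity is the classical
  fundamental theorem of calculus along the segment.\<close>

lemma weak_gradient_segment:
  fixes \<phi> :: "real^'n \<Rightarrow> real" and g :: "real^'n \<Rightarrow> real^'n"
  assumes \<phi>: "loc_int \<phi>" and g: "loc_int g"
    and weak: "\<And>\<psi> i. test_function \<psi> \<Longrightarrow>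
        (LINT x|lborel. \<phi> x * partial_deriv i \<psi> x) = - (LINT x|lborel. g x $ i * \<psi> x)"
  shows "AE x in lborel. \<phi> (x + y) - \<phi> x = (LINT t|lborel. indicator {0..1} t * (g (x + t *\<^sub>R y) \<bullet> y))"
proof -
  define h where "h x = (LINT t|lborel. indicator {0..1} t * (g (x + t *\<^sub>R y) \<bullet> y))" for x
  note [measurable] = loc_int_measurable[OF \<phi>] loc_int_measurable[OF g]
  have h_eq: "(LINT t|lborel. indicator {0..1} t * (g (x + t *\<^sub>R y) \<bullet> y * c)) = h x * c" for x c
    by (simp add: h_def flip: mult.assoc)
  have h: "loc_int h"
    unfolding loc_int_def set_integrable_def
  proof (intro conjI allI)
    show "h \<in> borel_measurable borel" unfolding h_def by measurable
    \<comment> \<open>Fubini's theorem with the indicator of a ball as multiplier: the inner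
      integral of a function integrable on the product is integrable.\<close>
    show "integrable lborel (\<lambda>x. indicat_real (cball 0 R) x *\<^sub>R h x)" for R
      using lborel_pair.integrable_fst'[OF integrable_segment_product(2)[OF loc_int_inner[OF g, of y],
          of "indicator (cball 0 R)" 1 R y]]
      by (simp add: h_eq borel_measurable_indicator mult.commute[of "indicator _ _" "h _"])
  qed
  have "AE x in lborel. \<phi> (y + x) - \<phi> x - h x = 0"
  proof (rule integral_zero_on_test_functions_imp_AE_zero)
    show "loc_int (\<lambda>x. \<phi> (y + x) - \<phi> x - h x)"
      by (intro loc_int_diff loc_int_shift \<phi> h)
    fix \<psi> :: "real^'n \<Rightarrow> real" assume \<psi>: "test_function \<psi>"
    have meas: "\<psi> \<in> borel_measurable borel" if "test_function \<psi>" for \<psi> :: "real^'n \<Rightarrow> real"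
      using test_function_continuous[OF that] by (rule borel_measurable_continuous_onI)
    note [measurable] = meas[OF \<psi>] meas[OF test_function_partial_deriv[OF \<psi>]]
    have int: "integrable lborel (\<lambda>x. f x * \<psi> x)"
      if "loc_int f" "test_function \<psi>" for f \<psi> :: "real^'n \<Rightarrow> real"
      by (rule test_function_bound[OF that(2)], rule loc_int_mult_integrable[OF that(1) meas[OF that(2)]])
    define D where "D x = (\<Sum>i\<in>UNIV. y $ i * partial_deriv i \<psi> x)" for x
    have [measurable]: "D \<in> borel_measurable borel" unfolding D_def by measurable
    have "\<exists>M R. \<forall>x. \<bar>partial_deriv i \<psi> x\<bar> \<le> M * indicator (cball 0 R) x" for i
      using test_function_bound[OF test_function_partial_deriv[OF \<psi>]] by metis
    then obtain M R where MR: "\<And>i x. \<bar>partial_deriv i \<psi> x\<bar> \<le> M i * indicator (cball 0 (R i)) x"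
      by metis
    have D_bound: "\<bar>D x\<bar> \<le> (\<Sum>i\<in>UNIV. \<bar>y $ i\<bar> * \<bar>M i\<bar>) * indicator (cball 0 (Max (range R))) x" for x
    proof -
      have "\<bar>y $ i * partial_deriv i \<psi> x\<bar> \<le> \<bar>y $ i\<bar> * \<bar>M i\<bar> * indicator (cball 0 (Max (range R))) x" for i
      proof -
        have "\<bar>partial_deriv i \<psi> x\<bar> \<le> \<bar>M i\<bar> * indicator (cball 0 (R i)) x"
          by (rule order_trans[OF MR]) (auto intro!: mult_right_mono)
        also have "\<dots> \<le> \<bar>M i\<bar> * indicator (cball 0 (Max (range R))) x"
          using Max_ge[of "range R" "R i"] by (intro mult_left_mono) (auto simp: indicator_def intro: order_trans)
        finally show ?thesis by (simp add: abs_mult mult.assoc mult_left_mono)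
      qed
      then have "(\<Sum>i\<in>UNIV. \<bar>y $ i * partial_deriv i \<psi> x\<bar>) \<le> (\<Sum>i\<in>UNIV. \<bar>y $ i\<bar> * \<bar>M i\<bar> * indicator (cball 0 (Max (range R))) x)"
        by (rule sum_mono)
      then show ?thesis
        unfolding D_def sum_distrib_right by (rule order_trans[OF sum_abs])
    qed
    obtain M' R' where \<psi>_bound: "\<And>x. \<bar>\<psi> x\<bar> \<le> M' * indicator (cball 0 R') x"
      using test_function_bound[OF \<psi>] by blast
    \<comment> \<open>The weak gradient is tested with the shifted function \<psi>(x - t y), the
      coordinates are combined with weights \<open>y $ i\<close>, and the shift is moved onto
      \<open>g\<close>.\<close>
    have dual: "(LINT x|lborel. \<phi> x * D (x - t *\<^sub>R y)) = - (LINT x|lborel. g (x + t *\<^sub>R y) \<bullet> y * \<psi> x)" for t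
    proof -
      let ?\<psi> = "\<lambda>x. \<psi> (x - t *\<^sub>R y)"
      have \<psi>t: "test_function ?\<psi>" by (rule test_function_shift[OF \<psi>])
      have pd: "partial_deriv i ?\<psi> x = partial_deriv i \<psi> (x - t *\<^sub>R y)" for i x
      proof -
        have "(?\<psi> has_derivative frechet_derivative \<psi> (at (x - t *\<^sub>R y))) (at x)"
          by (rule has_derivative_compose[where f = "\<lambda>x. x - t *\<^sub>R y", OF _ test_function_has_derivative[OF \<psi>], simplified])
             (auto intro!: derivative_eq_intros)
        then show ?thesis by (simp only: partial_deriv_eq) (simp add: partial_deriv_def)
      qed
      have "(LINT x|lborel. \<phi> x * D (x - t *\<^sub>R y)) = (LINT x|lborel. (\<Sum>i\<in>UNIV. y $ i * (\<phi> x * partial_deriv i ?\<psi> x)))"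
        by (simp add: D_def pd sum_distrib_left mult_ac)
      also have "\<dots> = (\<Sum>i\<in>UNIV. y $ i * (LINT x|lborel. \<phi> x * partial_deriv i ?\<psi> x))"
        by (subst Bochner_Integration.integral_sum) (auto intro!: int \<phi> test_function_partial_deriv \<psi>t)
      also have "\<dots> = - (\<Sum>i\<in>UNIV. y $ i * (LINT x|lborel. g x $ i * ?\<psi> x))"
        by (simp add: weak[OF \<psi>t] sum_negf)
      also have "(\<Sum>i\<in>UNIV. y $ i * (LINT x|lborel. g x $ i * ?\<psi> x)) = (LINT x|lborel. (\<Sum>i\<in>UNIV. y $ i * (g x $ i * ?\<psi> x)))"
      proof (subst Bochner_Integration.integral_sum)
        have "loc_int (\<lambda>x. g x $ i)" for i
          using loc_int_inner[OF g, of "axis i 1"] by (simp add: inner_axis)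
        then show "integrable lborel (\<lambda>x. y $ i * (g x $ i * ?\<psi> x))" for i
          by (intro integrable_mult_right int \<psi>t)
      qed simp
      also have "\<dots> = (LINT x|lborel. g x \<bullet> y * ?\<psi> x)"
        by (simp add: inner_vec_def sum_distrib_left sum_distrib_right mult_ac)
      also have "\<dots> = (LINT x|lborel. g (x + t *\<^sub>R y) \<bullet> y * \<psi> x)"
        using lborel_integral_shift[of "\<lambda>x. g x \<bullet> y * ?\<psi> x" "t *\<^sub>R y"] by (simp add: add.commute)
      finally show ?thesis .
    qed
    have "(LINT x|lborel. \<phi> (y + x) * \<psi> x) = (LINT x|lborel. \<phi> x * \<psi> (x - y))"
      using lborel_integral_shift[of "\<lambda>x. \<phi> x * \<psi> (x - y)" y] by simp
    then have "(LINT x|lborel. \<phi> (y + x) * \<psi> x) - (LINT x|lborel. \<phi> x * \<psi> x)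
        = (LINT x|lborel. \<phi> x * (\<psi> (x - y) - \<psi> x))"
      using int[OF \<phi> \<psi>] int[OF \<phi> test_function_shift[OF \<psi>]] by (simp add: right_diff_distrib)
    also have "\<dots> = - (LINT x|lborel. LINT t|lborel. indicator {0..1} t * (\<phi> x * D (x - t *\<^sub>R y)))"
      by (simp add: test_function_segment[OF \<psi>] D_def[symmetric] mult.left_commute[of "indicator _ _"])
    also have "(LINT x|lborel. LINT t|lborel. indicator {0..1} t * (\<phi> x * D (x - t *\<^sub>R y)))
        = (LINT t|lborel. LINT x|lborel. indicator {0..1} t * (\<phi> x * D (x - t *\<^sub>R y)))"
      by (rule lborel_pair.Fubini_integral[symmetric], rule integrable_segment_product(1)[OF \<phi> _ D_bound]) measurable
    also have "\<dots> = - (LINT t|lborel. LINT x|lborel. indicator {0..1} t * (g (x + t *\<^sub>R y) \<bullet> y * \<psi> x))"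
      by (simp add: dual)
    also have "(LINT t|lborel. LINT x|lborel. indicator {0..1} t * (g (x + t *\<^sub>R y) \<bullet> y * \<psi> x))
       = (LINT x|lborel. LINT t|lborel. indicator {0..1} t * (g (x + t *\<^sub>R y) \<bullet> y * \<psi> x))"
      by (rule lborel_pair.Fubini_integral, rule integrable_segment_product(2)[OF loc_int_inner[OF g] _ \<psi>_bound]) measurable
    also have "\<dots> = (LINT x|lborel. h x * \<psi> x)"
      by (simp add: h_eq)
    finally show "(LINT x|lborel. (\<phi> (y + x) - \<phi> x - h x) * \<psi> x) = 0"
      using int[OF loc_int_shift[OF \<phi>] \<psi>, of y] int[OF \<phi> \<psi>] int[OF h \<psi>] by (simp add: left_diff_distrib)
  qed
  then show ?thesis by (simp add: h_def add.commute)
qed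

section \<open>Jensen's inequality on the unit interval and the size of differences\<close>

text \<open>A convex function lies above its tangent at A; here this is weighted AM-GM with weights
  1/r and 1 - 1/r. Integrated over [0,1], it yields Jensen's inequality.\<close>

lemma powr_tangent_le:
  fixes a A r :: real
  assumes "0 \<le> a" "0 < A" "1 \<le> r"
  shows "A powr r + r * A powr (r - 1) * (a - A) \<le> a powr r"
proof (cases "a = 0")
  case True
  have "A powr r + r * A powr (r - 1) * (a - A) = (1 - r) * A powr r"
    using True assms by (simp add: powr_diff algebra_simps)
  also have "\<dots> \<le> 0" using assms by (simp add: mult_nonpos_nonneg)
  finally show ?thesis using True by simp
next
  case False
  then have "0 < a" using assms by simp
  have "(a powr r) powr (1 / r) * (A powr r) powr (1 - 1 / r) \<le> 1 / r * a powr r + (1 - 1 / r) * A powr r"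
    using assms False by (intro Youngs_inequality_0) auto
  moreover have "r * (1 - 1 / r) = r - 1"
    using assms by (simp add: field_simps)
  ultimately have *: "a * A powr (r - 1) \<le> 1 / r * a powr r + (1 - 1 / r) * A powr r"
    using assms \<open>0 < a\<close> by (simp add: powr_powr)
  have "r * (a * A powr (r - 1)) \<le> r * (1 / r * a powr r + (1 - 1 / r) * A powr r)"
    using assms by (intro mult_left_mono *) simp
  also have "\<dots> = a powr r + (r - 1) * A powr r"
    using assms by (simp add: field_simps)
  finally have "r * (a * A powr (r - 1)) \<le> a powr r + (r - 1) * A powr r" .
  moreover have "A powr r = A * A powr (r - 1)"
    using powr_mult_base[of A "r - 1"] assms by simp
  ultimately show ?thesis
    by (simp add: algebra_simps)
qed

lemma powr_integral_unit_interval_le: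
  fixes f :: "real \<Rightarrow> real"
  assumes [measurable]: "f \<in> borel_measurable borel" and r: "1 \<le> r"
  shows "ennreal (\<bar>LINT t|lborel. indicator {0..1} t * f t\<bar> powr r)
    \<le> (\<integral>\<^sup>+t. ennreal (indicator {0..1} t * \<bar>f t\<bar> powr r) \<partial>lborel)"
proof -
  define A where "A = \<bar>LINT t|lborel. indicator {0..1} t * f t\<bar>"
  \<comment> \<open>The Bochner integral of a non-integrable function is 0 by default, so
    \<open>0 < A\<close> forces integrability. The first two cases are trivial.\<close>
  consider "A = 0" | "(\<integral>\<^sup>+t. ennreal (indicator {0..1} t * \<bar>f t\<bar> powr r) \<partial>lborel) = \<infinity>"
    | "0 < A" "(\<integral>\<^sup>+t. ennreal (indicator {0..1} t * \<bar>f t\<bar> powr r) \<partial>lborel) < \<infinity>"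
    unfolding A_def by (auto simp: less_top[symmetric])
  then show ?thesis
  proof cases
    case 3
    have f: "integrable lborel (\<lambda>t. indicator {0..1} t * f t)"
      using 3(1) not_integrable_integral_eq unfolding A_def by force
    then have f': "integrable lborel (\<lambda>t. indicator {0..1} t * \<bar>f t\<bar>)"
      using integrable_abs[OF f] by (simp add: abs_mult)
    have fr: "integrable lborel (\<lambda>t. indicator {0..1} t * \<bar>f t\<bar> powr r)"
      using 3(2) by (intro integrableI_nonneg) auto
    have c: "integrable lborel (\<lambda>t. indicator {0..1::real} t * c)" for c :: real
      by simp
    have "A \<le> (LINT t|lborel. \<bar>indicator {0..1} t * f t\<bar>)"
      unfolding A_def by (rule integral_abs_bound)
    also have "\<dots> = (LINT t|lborel. indicator {0..1} t * \<bar>f t\<bar>)"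
      by (simp add: abs_mult)
    finally have A: "A \<le> (LINT t|lborel. indicator {0..1} t * \<bar>f t\<bar>)" .
    let ?k = "r * A powr (r - 1)"
    have "A powr r \<le> (A powr r - ?k * A) + ?k * (LINT t|lborel. indicator {0..1} t * \<bar>f t\<bar>)"
      using mult_left_mono[OF A, of ?k] r by simp
    also have "\<dots> = (LINT t|lborel. indicator {0..1} t * (A powr r - ?k * A) + ?k * (indicator {0..1} t * \<bar>f t\<bar>))"
      using c f' by simp
    also have "\<dots> \<le> (LINT t|lborel. indicator {0..1} t * \<bar>f t\<bar> powr r)"
    proof (rule integral_mono)
      show "indicator {0..1} t * (A powr r - ?k * A) + ?k * (indicator {0..1} t * \<bar>f t\<bar>)
          \<le> indicator {0..1} t * \<bar>f t\<bar> powr r" for t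
        using powr_tangent_le[of "\<bar>f t\<bar>" A r] 3(1) r by (auto simp: indicator_def algebra_simps)
    qed (use c f' fr in \<open>auto\<close>)
    finally have "ennreal (A powr r) \<le> ennreal (LINT t|lborel. indicator {0..1} t * \<bar>f t\<bar> powr r)"
      by (rule ennreal_leI)
    also have "\<dots> = (\<integral>\<^sup>+t. ennreal (indicator {0..1} t * \<bar>f t\<bar> powr r) \<partial>lborel)"
      using fr by (intro nn_integral_eq_integral[symmetric]) auto
    finally show ?thesis by (simp add: A_def)
  qed (auto simp: A_def[symmetric])
qed

text \<open>Jensen's inequality moves the power under the integral over t. After Tonelli every t
  contributes the same amount, by translation invariance.\<close>

lemma nn_integral_powr_shift_diff_le:
  fixes \<phi> :: "real^'n \<Rightarrow> real" and g :: "real^'n \<Rightarrow> real^'n"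
  assumes \<phi>: "loc_int \<phi>" and g: "loc_int g"
    and weak: "\<And>\<psi> i. test_function \<psi> \<Longrightarrow>
        (LINT x|lborel. \<phi> x * partial_deriv i \<psi> x) = - (LINT x|lborel. g x $ i * \<psi> x)"
    and r: "1 \<le> r"
  shows "(\<integral>\<^sup>+x. ennreal (\<bar>\<phi> (x + y) - \<phi> x\<bar> powr r) \<partial>lborel)
    \<le> ennreal (norm y powr r) * (\<integral>\<^sup>+x. ennreal (norm (g x) powr r) \<partial>lborel)"
proof -
  note [measurable] = loc_int_measurable[OF \<phi>] loc_int_measurable[OF g]
  have "(\<integral>\<^sup>+x. ennreal (\<bar>\<phi> (x + y) - \<phi> x\<bar> powr r) \<partial>lborel)
      \<le> (\<integral>\<^sup>+x. \<integral>\<^sup>+t. ennreal (indicator {0..1} t * \<bar>g (x + t *\<^sub>R y) \<bullet> y\<bar> powr r) \<partial>lborel \<partial>lborel)"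
    using weak_gradient_segment[OF \<phi> g weak, of y]
    by (intro nn_integral_mono_AE) (auto elim!: eventually_mono intro!: powr_integral_unit_interval_le r)
  also have "\<dots> = (\<integral>\<^sup>+t. \<integral>\<^sup>+x. ennreal (indicator {0..1} t * \<bar>g (x + t *\<^sub>R y) \<bullet> y\<bar> powr r) \<partial>lborel \<partial>lborel)"
    by (rule lborel_pair.Fubini'[symmetric]) measurable
  also have "\<dots> \<le> (\<integral>\<^sup>+t. ennreal (norm y powr r) * (\<integral>\<^sup>+x. ennreal (norm (g x) powr r) \<partial>lborel) * indicator {0..1::real} t \<partial>lborel)"
  proof (rule nn_integral_mono)
    fix t :: real
    have "(\<integral>\<^sup>+x. ennreal (indicator {0..1} t * \<bar>g (x + t *\<^sub>R y) \<bullet> y\<bar> powr r) \<partial>lborel)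
      \<le> (\<integral>\<^sup>+x. indicator {0..1} t * (ennreal (norm y powr r) * ennreal (norm (g (x + t *\<^sub>R y)) powr r)) \<partial>lborel)"
    proof (rule nn_integral_mono)
      fix x
      have "\<bar>g (x + t *\<^sub>R y) \<bullet> y\<bar> powr r \<le> (norm (g (x + t *\<^sub>R y)) * norm y) powr r"
        using r by (intro powr_mono2 Cauchy_Schwarz_ineq2) auto
      then show "ennreal (indicator {0..1} t * \<bar>g (x + t *\<^sub>R y) \<bullet> y\<bar> powr r)
        \<le> indicator {0..1} t * (ennreal (norm y powr r) * ennreal (norm (g (x + t *\<^sub>R y)) powr r))"
        by (auto simp: indicator_def powr_mult mult.commute simp flip: ennreal_mult intro!: ennreal_leI)
    qed
    also have "\<dots> = indicator {0..1} t * (ennreal (norm y powr r) * (\<integral>\<^sup>+x. ennreal (norm (g (x + t *\<^sub>R y)) powr r) \<partial>lborel))"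
      by (simp add: nn_integral_cmult)
    also have "(\<integral>\<^sup>+x. ennreal (norm (g (x + t *\<^sub>R y)) powr r) \<partial>lborel) = (\<integral>\<^sup>+x. ennreal (norm (g x) powr r) \<partial>lborel)"
      using lborel_nn_integral_shift[of "\<lambda>x. ennreal (norm (g x) powr r)" "t *\<^sub>R y"] by (simp add: add.commute)
    finally show "(\<integral>\<^sup>+x. ennreal (indicator {0..1} t * \<bar>g (x + t *\<^sub>R y) \<bullet> y\<bar> powr r) \<partial>lborel)
      \<le> ennreal (norm y powr r) * (\<integral>\<^sup>+x. ennreal (norm (g x) powr r) \<partial>lborel) * indicator {0..1::real} t"
      by (simp add: mult.commute)
  qed
  also have "\<dots> = ennreal (norm y powr r) * (\<integral>\<^sup>+x. ennreal (norm (g x) powr r) \<partial>lborel)"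
    by (simp add: nn_integral_cmult_indicator)
  finally show ?thesis .
qed

text \<open>Half of a cube of volume \<open>2 m\<close>, where \<open>m\<close> is the measure of \<open>{\<phi> > t}\<close>, translates a point of
  \<open>{\<phi> > 2t}\<close> out of \<open>{\<phi> > t}\<close>.\<close>

lemma level_set_measure_doubling:
  fixes \<phi> :: "real^'n \<Rightarrow> real"
  assumes [measurable]: "\<phi> \<in> borel_measurable borel"
    and shift: "\<And>y. (\<integral>\<^sup>+x. ennreal (\<bar>\<phi> (x + y) - \<phi> x\<bar> powr r) \<partial>lborel) \<le> ennreal (norm y powr r * I)"
    and fin: "emeasure lborel {x. t < \<phi> x} < \<infinity>" and t: "0 < t" and r: "1 \<le> r" and I: "0 \<le> I"
  shows "t powr r * measure lborel {x. 2 * t < \<phi> x}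
    \<le> 2 * (real CARD('n) * (2 * measure lborel {x. t < \<phi> x}) powr (1 / real CARD('n))) powr r * I"
proof -
  define E F where "E = {x. t < \<phi> x}" and "F = {x. 2 * t < \<phi> x}"
  have [measurable]: "E \<in> sets borel" "F \<in> sets borel"
    by (auto simp: E_def F_def)
  have E: "emeasure lborel E = ennreal (measure lborel E)"
    using fin by (intro emeasure_eq_ennreal_measure) (auto simp: E_def)
  have sub: "F \<subseteq> E" using t by (auto simp: E_def F_def)
  have Fle: "emeasure lborel F \<le> emeasure lborel E" by (rule emeasure_mono[OF sub]) simp
  then have F: "emeasure lborel F = ennreal (measure lborel F)"
    using E by (intro emeasure_eq_ennreal_measure) (auto simp: top_unique)
  define m where "m = measure lborel E"
  have mle: "measure lborel F \<le> m"
    using Fle E F by (simp add: m_def)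
  show ?thesis
  proof (cases "m = 0")
    case True
    then have "measure lborel F = 0" using mle by (simp add: measure_le_0_iff)
    then show ?thesis using True I by (simp add: E_def F_def m_def)
  next
    case False
    then have m: "0 < m" by (simp add: m_def zero_less_measure_iff)
    define h where "h = (2 * m) powr (1 / real CARD('n))"
    have h: "0 < h" using m by (simp add: h_def)
    define Q :: "(real^'n) set" where "Q = cbox 0 (\<chi> i. h)"
    have [measurable]: "Q \<in> sets borel" by (simp add: Q_def)
    have Qne: "Q \<noteq> {}" using h by (auto simp: Q_def interval_ne_empty_cart)
    have "measure lborel Q = h ^ CARD('n)"
      using Qne by (simp add: Q_def content_cbox_cart)
    also have "\<dots> = 2 * m"
      using m by (simp add: h_def powr_powr flip: powr_realpow)
    finally have Q: "emeasure lborel Q = ennreal (2 * m)"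
      using emeasure_lborel_cbox_finite[of 0 "\<chi> i. h"] by (metis Q_def emeasure_eq_ennreal_measure less_irrefl infinity_ennreal_def)
    have Qnorm: "norm y \<le> real CARD('n) * h" if "y \<in> Q" for y
    proof -
      have "norm y \<le> (\<Sum>i\<in>UNIV. \<bar>y $ i\<bar>)" by (rule norm_le_l1_cart)
      also have "\<dots> \<le> (\<Sum>i\<in>(UNIV::'n set). h)"
        using that by (intro sum_mono) (auto simp: Q_def mem_box_cart)
      finally show ?thesis by simp
    qed
    \<comment> \<open>Shifting \<open>E\<close> by -x keeps its measure m, so \<open>S\<close>, the
      part of \<open>Q\<close> that moves x out of \<open>E\<close>, has measure at least 2m - m.
      For x in \<open>F\<close> and y in \<open>S\<close> one has \<phi>(x) > 2t and \<phi>(x + y)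
      \<le> t, hence a difference of more than t.\<close>
    have lower: "ennreal (t powr r * m) * indicator F x
        \<le> (\<integral>\<^sup>+y. ennreal (\<bar>\<phi> (x + y) - \<phi> x\<bar> powr r) * indicator Q y \<partial>lborel)" for x
    proof (cases "x \<in> F")
      case True
      define S where "S = Q - {y. x + y \<in> E}"
      have [measurable]: "S \<in> sets borel" unfolding S_def by measurable
      have "emeasure lborel {y. x + y \<in> E} = (\<integral>\<^sup>+y. indicator {y. x + y \<in> E} y \<partial>lborel)"
        by (rule nn_integral_indicator[symmetric]) measurable
      also have "\<dots> = (\<integral>\<^sup>+y. indicator E (x + y) \<partial>lborel)"
        by (rule nn_integral_cong) (simp add: indicator_def)
      also have "\<dots> = emeasure lborel E"
        by (subst lborel_nn_integral_shift) auto
      finally have "emeasure lborel {y. x + y \<in> E} = ennreal m"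
        using E by (simp add: m_def)
      moreover have "emeasure lborel Q \<le> emeasure lborel S + emeasure lborel {y. x + y \<in> E}"
        by (rule order_trans[OF emeasure_mono emeasure_subadditive]) (auto simp: S_def)
      ultimately have "ennreal (2 * m) \<le> emeasure lborel S + ennreal m"
        using Q by simp
      moreover have "ennreal (2 * m) = ennreal m + ennreal m"
        using m by (simp flip: ennreal_plus)
      ultimately have "ennreal m \<le> emeasure lborel S"
        by (simp add: ennreal_add_left_cancel_le add.commute)
      then have "ennreal (t powr r * m) \<le> ennreal (t powr r) * emeasure lborel S"
        using m by (auto simp: ennreal_mult intro!: mult_left_mono)
      also have "\<dots> = (\<integral>\<^sup>+y. ennreal (t powr r) * indicator S y \<partial>lborel)"
        by (simp add: nn_integral_cmult_indicator)
      also have "\<dots> \<le> (\<integral>\<^sup>+y. ennreal (\<bar>\<phi> (x + y) - \<phi> x\<bar> powr r) * indicator Q y \<partial>lborel)"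
      proof (rule nn_integral_mono)
        show "ennreal (t powr r) * indicator S y \<le> ennreal (\<bar>\<phi> (x + y) - \<phi> x\<bar> powr r) * indicator Q y" for y
          using True t r by (auto simp: S_def E_def F_def indicator_def intro!: ennreal_leI powr_mono2)
      qed
      finally show ?thesis using True by simp
    qed simp
    have "ennreal (t powr r * m) * emeasure lborel F = (\<integral>\<^sup>+x. ennreal (t powr r * m) * indicator F x \<partial>lborel)"
      by (simp add: nn_integral_cmult_indicator)
    also have "\<dots> \<le> (\<integral>\<^sup>+x. \<integral>\<^sup>+y. ennreal (\<bar>\<phi> (x + y) - \<phi> x\<bar> powr r) * indicator Q y \<partial>lborel \<partial>lborel)"
      by (rule nn_integral_mono) (rule lower)
    also have "\<dots> = (\<integral>\<^sup>+y. \<integral>\<^sup>+x. ennreal (\<bar>\<phi> (x + y) - \<phi> x\<bar> powr r) * indicator Q y \<partial>lborel \<partial>lborel)"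
      by (rule lborel_pair.Fubini'[symmetric]) measurable
    also have "\<dots> \<le> (\<integral>\<^sup>+y. ennreal ((real CARD('n) * h) powr r * I) * indicator Q y \<partial>lborel)"
    proof (rule nn_integral_mono)
      fix y :: "real^'n"
      have "(\<integral>\<^sup>+x. ennreal (\<bar>\<phi> (x + y) - \<phi> x\<bar> powr r) \<partial>lborel) \<le> ennreal ((real CARD('n) * h) powr r * I)" if "y \<in> Q"
        using I r that by (intro order_trans[OF shift] ennreal_leI mult_right_mono powr_mono2 Qnorm) auto
      then show "(\<integral>\<^sup>+x. ennreal (\<bar>\<phi> (x + y) - \<phi> x\<bar> powr r) * indicator Q y \<partial>lborel)
        \<le> ennreal ((real CARD('n) * h) powr r * I) * indicator Q y"
        by (auto simp: indicator_def)
    qed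
    also have "\<dots> = ennreal ((real CARD('n) * h) powr r * I * (2 * m))"
      using m I by (simp add: nn_integral_cmult_indicator Q ennreal_mult)
    finally have "t powr r * m * measure lborel F \<le> (real CARD('n) * h) powr r * I * (2 * m)"
      using m I by (simp add: F flip: ennreal_mult)
    \<comment> \<open>The measure of \<open>S\<close> on the left and that of \<open>Q\<close> on
      the right are both proportional to m, which cancels; only the ratio 2 survives.\<close>
    then have "(t powr r * measure lborel F) * m \<le> (2 * (real CARD('n) * h) powr r * I) * m"
      by (simp add: mult_ac)
    then have "t powr r * measure lborel F \<le> 2 * (real CARD('n) * h) powr r * I"
      using m by (simp only: mult_le_cancel_right_pos)
    then show ?thesis by (simp add: E_def F_def m_def h_def)
  qed
qed

section \<open>Decay of level sets\<close>

lemma lebesgue_borel_representative: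
  fixes f :: "'a::euclidean_space \<Rightarrow> 'b::euclidean_space"
  assumes "f \<in> borel_measurable lebesgue"
  obtains f' where "f' \<in> borel_measurable borel" "AE x in lborel. f x = f' x"
proof -
  have "\<exists>h\<in>borel_measurable lborel. AE x in lborel. f x \<bullet> b = h x" for b
    by (rule completion_ex_borel_measurable_real) (use assms in measurable)
  then obtain h where h: "\<And>b. h b \<in> borel_measurable lborel" "\<And>b. AE x in lborel. f x \<bullet> b = h b x"
    by metis
  have "AE x in lborel. \<forall>b\<in>Basis. f x \<bullet> b = h b x"
    using h(2) by (intro AE_ball_countable') (auto intro: countable_finite)
  then have "AE x in lborel. f x = (\<Sum>b\<in>Basis. h b x *\<^sub>R b)"
    by eventually_elim (metis (no_types, lifting) euclidean_representation sum.cong)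
  moreover have "(\<lambda>x. \<Sum>b\<in>Basis. h b x *\<^sub>R b) \<in> borel_measurable borel"
    using h(1) by simp
  ultimately show ?thesis using that by blast
qed

lemma locally_integrable_measurable:
  assumes "locally_integrable f"
  shows "f \<in> borel_measurable lebesgue"
proof (rule borel_measurable_LIMSEQ_metric)
  show "(\<lambda>x. indicator (cball 0 (real N)) x *\<^sub>R f x) \<in> borel_measurable lebesgue" for N
    using assms unfolding locally_integrable_def set_integrable_def
    by (intro borel_measurable_integrable) auto
  show "(\<lambda>N. indicator (cball 0 (real N)) x *\<^sub>R f x) \<longlonglongrightarrow> f x" for x
  proof (rule tendsto_eventually)
    show "\<forall>\<^sub>F N in sequentially. indicator (cball 0 (real N)) x *\<^sub>R f x = f x"
      using eventually_ge_at_top[of "nat \<lceil>norm x\<rceil>"]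
      by eventually_elim (auto simp: indicator_def nat_le_iff ceiling_le_iff)
  qed
qed

lemma integrable_lebesgue_imp_lborel:
  fixes f f' :: "'a::euclidean_space \<Rightarrow> 'b::{banach, second_countable_topology}"
  assumes "integrable lebesgue f" "f' \<in> borel_measurable borel" "AE x in lborel. f x = f' x"
  shows "integrable lborel f'"
proof -
  have "integrable lebesgue f'"
    using assms by (subst integrable_cong_AE[of _ _ f]) (auto intro: measurable_completion AE_completion elim: eventually_mono)
  then show ?thesis
    using assms(2) by (subst (asm) integrable_completion) auto
qed

lemma locally_integrable_representative:
  assumes "locally_integrable f"
  obtains f' where "loc_int f'" "AE x in lborel. f x = f' x"
proof -
  note [measurable] = locally_integrable_measurable[OF assms]
  obtain f' where f' [measurable]: "f' \<in> borel_measurable borel" and ae: "AE x in lborel. f x = f' x"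
    using lebesgue_borel_representative[OF locally_integrable_measurable[OF assms]] .
  have "integrable lebesgue (\<lambda>x. indicator (cball 0 R) x *\<^sub>R f x)" for R
    using assms by (auto simp: locally_integrable_def set_integrable_def)
  moreover have "(\<lambda>x. indicator (cball 0 R) x *\<^sub>R f' x) \<in> borel_measurable borel" for R
    by (intro borel_measurable_scaleR borel_measurable_indicator) auto
  moreover have "AE x in lborel. indicator (cball 0 R) x *\<^sub>R f x = indicator (cball 0 R) x *\<^sub>R f' x" for R
    using ae by eventually_elim simp
  ultimately have "integrable lborel (\<lambda>x. indicator (cball 0 R) x *\<^sub>R f' x)" for R
    by (rule integrable_lebesgue_imp_lborel)
  then show ?thesis
    using that[of f'] ae by (auto simp: loc_int_def set_integrable_def)
qed

lemma integral_lebesgue_eq_lborel: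
  fixes f f' :: "'a::euclidean_space \<Rightarrow> 'b::{banach, second_countable_topology}"
  assumes "f \<in> borel_measurable lebesgue" "f' \<in> borel_measurable borel" "AE x in lborel. f x = f' x"
  shows "integral\<^sup>L lebesgue f = integral\<^sup>L lborel f'"
proof -
  have "integral\<^sup>L lebesgue f = integral\<^sup>L lebesgue f'"
    using assms by (intro integral_cong_AE AE_completion) (auto intro: measurable_completion)
  also have "\<dots> = integral\<^sup>L lborel f'"
    using assms by (intro integral_completion) simp
  finally show ?thesis .
qed

lemma test_function_measurable: "test_function \<psi> \<Longrightarrow> \<psi> \<in> borel_measurable borel"
  by (intro borel_measurable_continuous_onI test_function_continuous)

lemma weak_gradient_representative:
  assumes weak: "has_weak_gradient u g"
    and u': "loc_int u'" "AE x in lborel. u x = u' x"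
    and g': "loc_int g'" "AE x in lborel. g x = g' x"
    and \<psi>: "test_function \<psi>"
  shows "(LINT x|lborel. u' x * partial_deriv i \<psi> x) = - (LINT x|lborel. g' x $ i * \<psi> x)"
proof -
  note [measurable] = loc_int_measurable[OF u'(1)] loc_int_measurable[OF g'(1)]
    test_function_measurable[OF \<psi>] test_function_measurable[OF test_function_partial_deriv[OF \<psi>]]
  have m: "u \<in> borel_measurable lebesgue" "g \<in> borel_measurable lebesgue"
    using weak locally_integrable_measurable by (auto simp: has_weak_gradient_def)
  have m\<psi>: "\<psi> \<in> borel_measurable lebesgue" "partial_deriv i \<psi> \<in> borel_measurable lebesgue"
    by (simp_all add: measurable_completion)
  have gi: "(\<lambda>x. g x $ i) \<in> borel_measurable lebesgue"
    using borel_measurable_inner[OF m(2) borel_measurable_const[of "axis i 1"]] by (simp add: inner_axis)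
  have g'i: "(\<lambda>x. g' x $ i) \<in> borel_measurable borel"
    using borel_measurable_inner[OF loc_int_measurable[OF g'(1)] borel_measurable_const[of "axis i 1"]]
    by (simp add: inner_axis)
  have "(LINT x|lborel. u' x * partial_deriv i \<psi> x) = (LINT x|lebesgue. u x * partial_deriv i \<psi> x)"
    using u'(2) m m\<psi> by (intro integral_lebesgue_eq_lborel[symmetric]) auto
  also have "\<dots> = - (LINT x|lebesgue. g x $ i * \<psi> x)"
    using weak \<psi> by (auto simp: has_weak_gradient_def)
  also have "(LINT x|lebesgue. g x $ i * \<psi> x) = (LINT x|lborel. g' x $ i * \<psi> x)"
    using g'(2) gi g'i m\<psi> by (intro integral_lebesgue_eq_lborel) auto
  finally show ?thesis .
qed

lemma loc_int_test_integrable: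
  assumes "loc_int f" "test_function \<psi>"
  shows "integrable lborel (\<lambda>x. f x * \<psi> x)"
  by (rule test_function_bound[OF assms(2)],
      rule loc_int_mult_integrable[OF assms(1) test_function_measurable[OF assms(2)]])

lemma loc_int_component:
  fixes g :: "'a::euclidean_space \<Rightarrow> real^'n"
  shows "loc_int g \<Longrightarrow> loc_int (\<lambda>x. g x $ i)"
  using loc_int_inner[of g "axis i 1"] by (simp add: inner_axis)

text \<open>Membership in \<open>sobolev_W1\<close> provides integrability for some weak gradient
  only; uniqueness carries it over to any given one. Apply the fundamental lemma to each component
  of the difference.\<close>

lemma weak_gradient_unique:
  fixes u :: "real^'n \<Rightarrow> real"
  assumes g: "has_weak_gradient u g" and h: "has_weak_gradient u h"
  shows "AE x in lborel. g x = h x"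
proof -
  obtain u' where u': "loc_int u'" "AE x in lborel. u x = u' x"
    using g locally_integrable_representative by (auto simp: has_weak_gradient_def)
  obtain g' where g': "loc_int g'" "AE x in lborel. g x = g' x"
    using g locally_integrable_representative by (auto simp: has_weak_gradient_def)
  obtain h' where h': "loc_int h'" "AE x in lborel. h x = h' x"
    using h locally_integrable_representative by (auto simp: has_weak_gradient_def)
  have "AE x in lborel. g' x $ i - h' x $ i = 0" for i
  proof (rule integral_zero_on_test_functions_imp_AE_zero)
    show "loc_int (\<lambda>x. g' x $ i - h' x $ i)"
      by (intro loc_int_diff loc_int_component g' h')
    fix \<psi> :: "real^'n \<Rightarrow> real" assume \<psi>: "test_function \<psi>"
    have "(LINT x|lborel. g' x $ i * \<psi> x) = (LINT x|lborel. h' x $ i * \<psi> x)"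
      using weak_gradient_representative[OF g u' g' \<psi>, of i] weak_gradient_representative[OF h u' h' \<psi>, of i]
      by simp
    then show "(LINT x|lborel. (g' x $ i - h' x $ i) * \<psi> x) = 0"
      using loc_int_test_integrable[OF loc_int_component[OF g'(1)] \<psi>]
        loc_int_test_integrable[OF loc_int_component[OF h'(1)] \<psi>]
      by (simp add: left_diff_distrib)
  qed
  then have "AE x in lborel. \<forall>i\<in>UNIV. g' x $ i - h' x $ i = 0"
    by (intro AE_ball_countable') (auto intro: countable_finite)
  then show ?thesis
    using g'(2) h'(2) by eventually_elim (simp add: vec_eq_iff)
qed

lemma sobolev_level_set_doubling:
  fixes \<phi> :: "real^'n \<Rightarrow> real"
  assumes \<phi>: "\<phi> \<in> sobolev_W1 r" and grad: "has_weak_gradient \<phi> grad"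
    and r: "1 \<le> r" and t: "0 < t" and fin: "emeasure lebesgue {x. t < \<phi> x} < \<infinity>"
  shows "t powr r * measure lebesgue {x. 2 * t < \<phi> x}
    \<le> 2 * (real CARD('n) * (2 * measure lebesgue {x. t < \<phi> x}) powr (1 / real CARD('n))) powr r
        * Lq_norm r grad powr r"
proof -
  obtain \<phi>' where \<phi>': "loc_int \<phi>'" "AE x in lborel. \<phi> x = \<phi>' x"
    using grad locally_integrable_representative by (auto simp: has_weak_gradient_def)
  obtain g where g: "has_weak_gradient \<phi> g" "g \<in> Lq_space r"
    using \<phi> by (auto simp: sobolev_W1_def)
  obtain g' where g': "loc_int g'" "AE x in lborel. grad x = g' x"
    using grad locally_integrable_representative by (auto simp: has_weak_gradient_def)
  note [measurable] = loc_int_measurable[OF \<phi>'(1)] loc_int_measurable[OF g'(1)]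
  have gg': "AE x in lborel. g x = g' x"
    using weak_gradient_unique[OF g(1) grad] g'(2) by eventually_elim simp
  define I where "I = (LINT x|lborel. norm (g' x) powr r)"
  have m: "(\<lambda>x. norm (g x) powr r) \<in> borel_measurable lebesgue" "(\<lambda>x. norm (grad x) powr r) \<in> borel_measurable lebesgue"
    using g(2) grad locally_integrable_measurable[of grad] by (auto simp: Lq_space_def has_weak_gradient_def)
  have I: "I = Lq_norm r grad powr r"
  proof -
    have "(LINT x|lebesgue. norm (grad x) powr r) = I"
      unfolding I_def using g'(2) m by (intro integral_lebesgue_eq_lborel) auto
    moreover have "0 \<le> I" by (simp add: I_def)
    ultimately show ?thesis using r by (simp add: Lq_norm_def powr_powr)
  qed
  \<comment> \<open>Integrability is inherited from the witness \<open>g\<close> of membership in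
    \<open>sobolev_W1\<close>, which agrees almost everywhere with \<open>grad\<close>.\<close>
  have int: "integrable lborel (\<lambda>x. norm (g' x) powr r)"
  proof (rule integrable_lebesgue_imp_lborel)
    show "integrable lebesgue (\<lambda>x. norm (g x) powr r)"
      using g(2) by (simp add: Lq_space_def)
    show "AE x in lborel. norm (g x) powr r = norm (g' x) powr r"
      using gg' by eventually_elim simp
  qed measurable
  have shift: "(\<integral>\<^sup>+x. ennreal (\<bar>\<phi>' (x + y) - \<phi>' x\<bar> powr r) \<partial>lborel) \<le> ennreal (norm y powr r * I)" for y
  proof -
    have "(\<integral>\<^sup>+x. ennreal (norm (g' x) powr r) \<partial>lborel) = ennreal I"
      unfolding I_def by (rule nn_integral_eq_integral[OF int]) simp
    then show ?thesis
      using nn_integral_powr_shift_diff_le[OF \<phi>'(1) g'(1) weak_gradient_representative[OF grad \<phi>' g'] r, of y]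
      by (subst ennreal_mult) (auto simp: I_def)
  qed
  have em: "emeasure lebesgue {x. c < \<phi> x} = emeasure lborel {x. c < \<phi>' x}" for c
  proof -
    have [measurable]: "\<phi> \<in> borel_measurable lebesgue"
      using grad locally_integrable_measurable by (auto simp: has_weak_gradient_def)
    have "emeasure lebesgue {x. c < \<phi> x} = emeasure lebesgue {x. c < \<phi>' x}"
    proof (rule emeasure_eq_AE)
      show "AE x in lebesgue. x \<in> {x. c < \<phi> x} \<longleftrightarrow> x \<in> {x. c < \<phi>' x}"
        using AE_completion[OF \<phi>'(2)] by eventually_elim simp
      have "{x \<in> space lebesgue. c < \<phi> x} \<in> sets lebesgue" by measurable
      then show "{x. c < \<phi> x} \<in> sets lebesgue" by simp
    qed auto
    then show ?thesis by simp
  qed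
  show ?thesis
    using level_set_measure_doubling[OF loc_int_measurable[OF \<phi>'(1)] shift _ t r] fin
    unfolding I[symmetric] by (simp add: measure_def em I_def)
qed

section \<open>Iteration of the doubling inequality\<close>

text \<open>The hypothesis on \<open>D\<close> says that the first step already gives D V^e / T^r
  \<le> V. The order satisfies p = r + \<beta> p, so the ansatz \<mu>(t) \<le> B V (t/T)^(-p)
  reproduces itself. The constant B = 2^(p/(1-\<beta>)) solves B^\<beta> = B 2^(-p), which pays for
  passing from t to 2t.\<close>

lemma doubling_decay:
  fixes \<mu> :: "real \<Rightarrow> real"
  assumes nonneg: "\<And>t. 0 \<le> \<mu> t" and mu_le: "\<And>t. T \<le> t \<Longrightarrow> \<mu> t \<le> V"
    and doubling: "\<And>t. T \<le> t \<Longrightarrow> t powr r * \<mu> (2 * t) \<le> D * \<mu> t powr e"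
    and T: "0 < T" "D \<le> T powr r * V powr (1 - e)" and V: "0 < V"
    and \<beta>: "0 < \<beta>" "\<beta> < 1" "\<beta> \<le> e" and r: "0 < r" and D: "0 \<le> D"
    and p: "p = r / (1 - \<beta>)"
  shows "\<mu> (2 ^ k * T) \<le> 2 powr (p / (1 - \<beta>)) * V * 2 powr (- (real k * p))"
proof (induction k)
  case 0
  have "1 \<le> 2 powr (p / (1 - \<beta>))"
    using p r \<beta> by (intro ge_one_powr_ge_zero) auto
  then have "V \<le> 2 powr (p / (1 - \<beta>)) * V"
    using V by simp
  then show ?case
    using mu_le[of T] by simp
next
  case (Suc k)
  define B where "B = 2 powr (p / (1 - \<beta>))"
  define t where "t = 2 ^ k * T"
  define R where "R = 2 powr (- (real k * p))"
  have B: "0 < B" and R: "0 < R" by (simp_all add: B_def R_def)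
  have t: "T \<le> t" "0 < t"
    using T by (simp_all add: t_def)
  \<comment> \<open>The exponent \<open>e\<close> may be 1 or larger. Only the part \<beta> < 1 of
    it is fed with the induction hypothesis; the rest is estimated by the trivial bound V.\<close>
  have "\<mu> t powr e \<le> V powr (e - \<beta>) * (B * V * R) powr \<beta>"
  proof -
    have "\<mu> t powr e = \<mu> t powr (e - \<beta>) * \<mu> t powr \<beta>"
      using nonneg by (simp flip: powr_add)
    also have "\<dots> \<le> V powr (e - \<beta>) * (B * V * R) powr \<beta>"
      using nonneg mu_le[OF t(1)] \<beta> Suc by (intro mult_mono powr_mono2) (auto simp: B_def R_def t_def)
    finally show ?thesis .
  qed
  then have "t powr r * \<mu> (2 * t) \<le> (T powr r * V powr (1 - e)) * (V powr (e - \<beta>) * (B * V * R) powr \<beta>)"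
    by (intro order_trans[OF doubling[OF t(1)]] mult_mono T) auto
  also have "\<dots> = T powr r * ((V powr (1 - e) * V powr (e - \<beta>) * V powr \<beta>) * B powr \<beta> * R powr \<beta>)"
    using V B R by (simp add: powr_mult)
  also have "V powr (1 - e) * V powr (e - \<beta>) * V powr \<beta> = V"
    using V by (simp flip: powr_add)
  also have "T powr r * (V * B powr \<beta> * R powr \<beta>) = t powr r * (V * B powr \<beta> * (2 powr (- (real k * r)) * R powr \<beta>))"
  proof -
    have "t powr r = 2 powr (real k * r) * T powr r"
      using T by (simp add: t_def powr_mult powr_powr flip: powr_realpow)
    moreover have "2 powr (real k * r) * 2 powr (- (real k * r)) = (1::real)"
      by (simp flip: powr_add)
    ultimately show ?thesis by (simp add: mult_ac)
  qed
  finally have "\<mu> (2 * t) \<le> V * B powr \<beta> * (2 powr (- (real k * r)) * R powr \<beta>)"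
    using t by (simp add: mult_le_cancel_left_pos)
  also have "2 powr (- (real k * r)) * R powr \<beta> = R"
  proof -
    have "r = p * (1 - \<beta>)"
      using p \<beta> by simp
    then have "real k * r = real k * (p * (1 - \<beta>))"
      by (rule arg_cong)
    then have "- (real k * r) + - (real k * p) * \<beta> = - (real k * p)"
      by (simp only: right_diff_distrib mult.assoc) simp
    then show ?thesis by (simp add: R_def powr_powr flip: powr_add)
  qed
  also have "B powr \<beta> = B * 2 powr (- p)"
  proof -
    have "p / (1 - \<beta>) * \<beta> = p / (1 - \<beta>) + - p"
      using \<beta> by (simp add: field_simps)
    then show ?thesis by (simp add: B_def powr_powr flip: powr_add)
  qed
  also have "V * (B * 2 powr (- p)) * R = B * V * 2 powr (- (real (Suc k) * p))"
  proof -
    have "2 powr (- p) * R = 2 powr (- (real (Suc k) * p))"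
      by (simp add: R_def algebra_simps flip: powr_add)
    then show ?thesis by (simp add: mult_ac)
  qed
  finally show ?case by (simp add: t_def B_def mult_ac)
qed

text \<open>Up to T the integrand is at most T^q on a set of measure at most V. The layer from 2^k T
  to 2^(k+1) T costs a multiple of 2^(k(q-p)), a convergent geometric series because q < p.\<close>

lemma dyadic_layer_bound:
  fixes \<phi> :: "'a \<Rightarrow> real"
  assumes [measurable]: "\<phi> \<in> borel_measurable M"
    and fin: "emeasure M {x \<in> space M. s < \<phi> x} \<le> ennreal V" and T: "0 < s" "s \<le> T"
    and decay: "\<And>k. measure M {x \<in> space M. 2 ^ k * T < \<phi> x} \<le> B * V * 2 powr (- (real k * p))"
    and q: "0 < q" "q < p" and V: "0 \<le> V" and B: "0 \<le> B"
  shows "(\<integral>\<^sup>+x. ennreal (\<phi> x powr q) * indicator {x. s < \<phi> x} x \<partial>M)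
    \<le> ennreal (T powr q * V * (1 + 2 powr q * B / (1 - 2 powr (q - p))))"
proof -
  define S where "S t = {x \<in> space M. t < \<phi> x}" for t
  have [measurable]: "S t \<in> sets M" for t unfolding S_def by measurable
  \<comment> \<open>Finiteness matters: \<open>measure\<close> is 0 on sets of infinite measure, and
    the decay hypothesis would then carry no information.\<close>
  have emS: "emeasure M (S t) = ennreal (measure M (S t))" if "s \<le> t" for t
  proof -
    have "emeasure M (S t) \<le> emeasure M (S s)"
      using that by (intro emeasure_mono) (auto simp: S_def)
    also note fin[folded S_def]
    finally show ?thesis
      by (intro emeasure_eq_ennreal_measure) (auto simp: top_unique)
  qed
  have sT: "s \<le> 2 ^ k * T" for k
    using T mult_mono[of 1 "2 ^ k" s T] by simp
  have pw: "(2 ^ Suc k * T) powr q * (B * V * 2 powr (- (real k * p))) = T powr q * V * (2 powr q * B) * (2 powr (q - p)) ^ k" for k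
  proof -
    have "(2 ^ Suc k * T) powr q = 2 powr (real (Suc k) * q) * T powr q"
      by (subst powr_realpow[symmetric], simp, simp only: powr_mult powr_powr)
    moreover have "2 powr (real (Suc k) * q) * 2 powr (- (real k * p)) = 2 powr q * (2 powr (q - p)) ^ k"
      by (simp add: powr_powr algebra_simps flip: powr_realpow powr_add)
    ultimately show ?thesis by (simp add: mult_ac)
  qed
  have "(\<integral>\<^sup>+x. ennreal (\<phi> x powr q) * indicator {x. s < \<phi> x} x \<partial>M)
    \<le> (\<integral>\<^sup>+x. ennreal (T powr q) * indicator (S s) x
         + (\<Sum>k. ennreal ((2 ^ Suc k * T) powr q) * indicator (S (2 ^ k * T)) x) \<partial>M)"
  proof (rule nn_integral_mono)
    fix x assume x: "x \<in> space M"
    show "ennreal (\<phi> x powr q) * indicator {x. s < \<phi> x} x \<le> ennreal (T powr q) * indicator (S s) x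
         + (\<Sum>k. ennreal ((2 ^ Suc k * T) powr q) * indicator (S (2 ^ k * T)) x)"
    proof (cases "s < \<phi> x")
      case True
      show ?thesis
      proof (cases "\<phi> x \<le> T")
        case le: True
        have "ennreal (\<phi> x powr q) * indicator {x. s < \<phi> x} x \<le> ennreal (T powr q) * indicator (S s) x"
          using True le T q x by (auto simp: S_def intro!: ennreal_leI powr_mono2)
        then show ?thesis by (rule order_trans) simp
      next
        case False
        \<comment> \<open>The index of the dyadic layer containing \<phi>(x); this single term of
          the series already dominates the integrand.\<close>
        define k where "k = (LEAST k. \<phi> x \<le> 2 ^ Suc k * T)"
        have "\<exists>k. \<phi> x \<le> 2 ^ Suc k * T"
        proof -
          obtain m where "\<phi> x / T < 2 ^ m"
            using real_arch_pow[of 2 "\<phi> x / T"] by auto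
          then have "\<phi> x < 2 ^ m * T" using T by (simp add: field_simps)
          also have "\<dots> \<le> 2 ^ Suc m * T" using T by simp
          finally show ?thesis by (intro exI[of _ m]) simp
        qed
        then have k: "\<phi> x \<le> 2 ^ Suc k * T"
          unfolding k_def by (rule LeastI_ex)
        have k': "2 ^ k * T < \<phi> x"
        proof (cases k)
          case (Suc j)
          then have "\<not> \<phi> x \<le> 2 ^ Suc j * T"
            using not_less_Least[of j "\<lambda>k. \<phi> x \<le> 2 ^ Suc k * T"] by (simp add: k_def)
          then show ?thesis using Suc by simp
        qed (use False in simp)
        define f where "f j = ennreal ((2 ^ Suc j * T) powr q) * indicator (S (2 ^ j * T)) x" for j
        have "ennreal (\<phi> x powr q) * indicator {x. s < \<phi> x} x \<le> sum f {k}"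
          using True k k' T q x by (auto simp: f_def S_def intro!: ennreal_leI powr_mono2)
        also have "\<dots> \<le> suminf f"
          by (rule sum_le_suminf) auto
        finally have "ennreal (\<phi> x powr q) * indicator {x. s < \<phi> x} x
          \<le> (\<Sum>j. ennreal ((2 ^ Suc j * T) powr q) * indicator (S (2 ^ j * T)) x)"
          by (simp only: f_def[abs_def])
        then show ?thesis by (rule order_trans) simp
      qed
    qed simp
  qed
  also have "\<dots> = ennreal (T powr q) * emeasure M (S s)
      + (\<Sum>k. ennreal ((2 ^ Suc k * T) powr q) * emeasure M (S (2 ^ k * T)))"
    by (simp add: nn_integral_add nn_integral_suminf nn_integral_cmult_indicator)
  also have "\<dots> \<le> ennreal (T powr q * V) + (\<Sum>k. ennreal (T powr q * V * (2 powr q * B) * (2 powr (q - p)) ^ k))"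
  proof (rule add_mono)
    show "ennreal (T powr q) * emeasure M (S s) \<le> ennreal (T powr q * V)"
      using fin V by (auto simp: S_def ennreal_mult intro!: mult_left_mono)
    have "ennreal ((2 ^ Suc k * T) powr q) * emeasure M (S (2 ^ k * T))
        \<le> ennreal (T powr q * V * (2 powr q * B) * (2 powr (q - p)) ^ k)" for k
      unfolding emS[OF sT] pw[symmetric] using decay[of k, folded S_def]
      by (subst ennreal_mult[symmetric]) (auto intro!: ennreal_leI mult_left_mono)
    then show "(\<Sum>k. ennreal ((2 ^ Suc k * T) powr q) * emeasure M (S (2 ^ k * T)))
        \<le> (\<Sum>k. ennreal (T powr q * V * (2 powr q * B) * (2 powr (q - p)) ^ k))"
      by (intro suminf_le) auto
  qed
  also have "(\<Sum>k. ennreal (T powr q * V * (2 powr q * B) * (2 powr (q - p)) ^ k))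
      = ennreal (T powr q * V * (2 powr q * B) * (1 / (1 - 2 powr (q - p))))"
  proof (rule suminf_ennreal_eq)
    have "2 powr (q - p) < 2 powr 0"
      using q by (intro powr_less_mono) auto
    then show "(\<lambda>k. T powr q * V * (2 powr q * B) * (2 powr (q - p)) ^ k) sums
      (T powr q * V * (2 powr q * B) * (1 / (1 - 2 powr (q - p))))"
      by (intro sums_mult geometric_sums) auto
  qed (use V B in auto)
  also have "ennreal (T powr q * V) + ennreal (T powr q * V * (2 powr q * B) * (1 / (1 - 2 powr (q - p))))
      = ennreal (T powr q * V * (1 + 2 powr q * B / (1 - 2 powr (q - p))))"
  proof (subst ennreal_plus[symmetric])
    have "2 powr (q - p) < 2 powr 0"
      using q by (intro powr_less_mono) auto
    then show "0 \<le> T powr q * V * (2 powr q * B) * (1 / (1 - 2 powr (q - p)))"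
      using V B by simp
  qed (use V in \<open>auto simp: algebra_simps\<close>)
  finally show ?thesis .
qed

text \<open>The exponent \<open>\<beta>\<close> is \<open>r / n\<close> below the critical dimension, which yields the decay rate
  \<open>p = r n / (n - r)\<close>; otherwise any sufficiently large \<open>\<beta> < 1\<close> yields a rate above \<open>q\<close>.\<close>

lemma decay_exponent:
  fixes r q n :: real
  assumes "1 \<le> r" "0 < q" "0 < n" "r < n \<Longrightarrow> q < r * n / (n - r)"
  obtains \<beta> where "0 < \<beta>" "\<beta> < 1" "\<beta> \<le> r / n" "q < r / (1 - \<beta>)"
proof (cases "r < n")
  case True
  have "r / (1 - r / n) = r * n / (n - r)"
    using True assms by (simp add: field_simps)
  then show ?thesis
    using that[of "r / n"] True assms by simp
next
  case False
  \<comment> \<open>The second entry makes r/(1 - \<beta>) at least 2q; the first keeps \<beta>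
    positive.\<close>
  define \<beta> where "\<beta> = max (1 / 2) (1 - r / (2 * q))"
  have "\<beta> < 1" "1 / 2 \<le> \<beta>" "1 - r / (2 * q) \<le> \<beta>"
    using assms by (auto simp: \<beta>_def)
  moreover have "1 \<le> r / n" using False assms by simp
  moreover have "q < r / (1 - \<beta>)"
  proof -
    have "q * (1 - \<beta>) \<le> q * (r / (2 * q))"
      using assms \<open>1 - r / (2 * q) \<le> \<beta>\<close> by (intro mult_left_mono) auto
    also have "\<dots> < r" using assms by simp
    finally show ?thesis using \<open>\<beta> < 1\<close> by (simp add: pos_less_divide_eq)
  qed
  ultimately show ?thesis using that[of \<beta>] by linarith
qed

text \<open>\<open>V\<close> is left free as any bound for the measure at level s, to be replaced
  later by K / L(s). The two summands correspond to the two candidates for the level from which the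
  decay starts.\<close>

lemma sobolev_superlevel_bound:
  fixes r q :: real
  assumes r: "1 \<le> r" and q: "0 < q"
    and sub: "r < real CARD('n) \<Longrightarrow> q < r * real CARD('n) / (real CARD('n) - r)"
  obtains C where "0 < C"
    "\<And>(\<phi> :: real^'n \<Rightarrow> real) grad s V. \<phi> \<in> sobolev_W1 r \<Longrightarrow> has_weak_gradient \<phi> grad \<Longrightarrow> 0 < s \<Longrightarrow> 0 < V \<Longrightarrow>
      emeasure lebesgue {x. s < \<phi> x} \<le> ennreal V \<Longrightarrow>
      (\<integral>\<^sup>+x. ennreal (\<phi> x powr q) * indicator {x. s < \<phi> x} x \<partial>lebesgue)
        \<le> ennreal (C * (s powr q + (Lq_norm r grad * V powr (1 / real CARD('n) - 1 / r)) powr q) * V)"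
proof -
  define n where "n = real CARD('n)"
  have n: "0 < n" by (simp add: n_def)
  obtain \<beta> where \<beta>: "0 < \<beta>" "\<beta> < 1" "\<beta> \<le> r / n" "q < r / (1 - \<beta>)"
    using decay_exponent[OF r q n] sub unfolding n_def by blast
  define p where "p = r / (1 - \<beta>)"
  define B where "B = 2 powr (p / (1 - \<beta>))"
  \<comment> \<open>The constant of the doubling inequality: 2 (n (2 \<mu>)^(1/n))^r = c
    \<mu>^(r/n).\<close>
  define c where "c = 2 * n powr r * 2 powr (r / n)"
  define A where "A = 1 + 2 powr q * B / (1 - 2 powr (q - p))"
  have c: "0 < c" using n by (simp add: c_def)
  have B: "0 < B" by (simp add: B_def)
  have qp: "q < p" using \<beta> by (simp add: p_def)
  have "2 powr (q - p) < 2 powr 0"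
    using qp by (intro powr_less_mono) auto
  then have A: "0 < A" using B by (auto simp: A_def intro!: add_pos_nonneg)
  define C where "C = A * (1 + (c powr (1 / r)) powr q)"
  have "0 < C"
    unfolding C_def using A by (intro mult_pos_pos add_pos_nonneg) auto
  moreover have "(\<integral>\<^sup>+x. ennreal (\<phi> x powr q) * indicator {x. s < \<phi> x} x \<partial>lebesgue)
        \<le> ennreal (C * (s powr q + (Lq_norm r grad * V powr (1 / real CARD('n) - 1 / r)) powr q) * V)"
    if \<phi>: "\<phi> \<in> sobolev_W1 r" and grad: "has_weak_gradient \<phi> grad" and s: "0 < s" and V: "0 < V"
      and em: "emeasure lebesgue {x. s < \<phi> x} \<le> ennreal V"
    for \<phi> :: "real^'n \<Rightarrow> real" and grad s V
  proof -
    define G where "G = Lq_norm r grad"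
    have G: "0 \<le> G" by (simp add: G_def Lq_norm_def)
    \<comment> \<open>\<open>t0\<close> solves t0^r V^(1 - r/n) = c G^r, that is, the starting
      condition of \<open>doubling_decay\<close> with equality. Any larger level, such as
      \<open>T\<close>, satisfies it too.\<close>
    define t0 where "t0 = c powr (1 / r) * G * V powr (1 / n - 1 / r)"
    define T where "T = max s t0"
    define \<mu> where "\<mu> t = measure lebesgue {x. t < \<phi> x}" for t
    have T: "0 < T" "s \<le> T" "t0 \<le> T" using s by (auto simp: T_def)
    have [measurable]: "\<phi> \<in> borel_measurable lebesgue"
      using \<phi> by (simp add: sobolev_W1_def Lq_space_def)
    have meas: "{x. t < \<phi> x} \<in> sets lebesgue" for t
    proof -
      have "{x \<in> space lebesgue. t < \<phi> x} \<in> sets lebesgue" by measurable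
      then show ?thesis by simp
    qed
    have em_t: "emeasure lebesgue {x. t < \<phi> x} \<le> ennreal V" if "s \<le> t" for t
      by (rule order_trans[OF emeasure_mono em]) (use that meas in auto)
    have decay: "\<mu> (2 ^ k * T) \<le> B * V * 2 powr (- (real k * p))" for k
      unfolding B_def
    proof (rule doubling_decay[where D = "c * G powr r" and e = "r / n"])
      show "\<mu> t \<le> V" if "T \<le> t" for t
        using em_t[of t] T that V by (simp add: \<mu>_def measure_def enn2real_leI)
      show "t powr r * \<mu> (2 * t) \<le> c * G powr r * \<mu> t powr (r / n)" if "T \<le> t" for t
      proof -
        have "emeasure lebesgue {x. t < \<phi> x} < \<infinity>"
          by (rule le_less_trans[OF em_t]) (use that T in auto)
        then have "t powr r * \<mu> (2 * t) \<le> 2 * (n * (2 * \<mu> t) powr (1 / n)) powr r * G powr r"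
          using sobolev_level_set_doubling[OF \<phi> grad r, of t] that T by (simp add: \<mu>_def n_def G_def)
        also have "\<dots> = c * G powr r * \<mu> t powr (r / n)"
          using n by (simp add: c_def powr_mult powr_powr \<mu>_def)
        finally show ?thesis .
      qed
      show "c * G powr r \<le> T powr r * V powr (1 - r / n)"
      proof -
        have "t0 powr r * V powr (1 - r / n) = c * G powr r * (V powr (r / n - 1) * V powr (1 - r / n))"
        proof -
          have "(1 / n - 1 / r) * r = r / n - 1" using r by (simp add: field_simps)
          then show ?thesis
            using c G V r by (simp add: t0_def powr_mult powr_powr)
        qed
        also have "V powr (r / n - 1) * V powr (1 - r / n) = 1"
          using V by (simp flip: powr_add)
        finally have "c * G powr r = t0 powr r * V powr (1 - r / n)" by simp
        also have "\<dots> \<le> T powr r * V powr (1 - r / n)"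
          using T r c G by (intro mult_right_mono powr_mono2) (auto simp: t0_def)
        finally show ?thesis .
      qed
    qed (use T V \<beta> r c in \<open>auto simp: \<mu>_def p_def\<close>)
    have "(\<integral>\<^sup>+x. ennreal (\<phi> x powr q) * indicator {x. s < \<phi> x} x \<partial>lebesgue) \<le> ennreal (T powr q * V * A)"
      unfolding A_def using em T s V B q qp decay by (intro dyadic_layer_bound) (auto simp: \<mu>_def)
    also have "\<dots> \<le> ennreal (C * (s powr q + (G * V powr (1 / n - 1 / r)) powr q) * V)"
    proof (rule ennreal_leI)
      define w where "w = (G * V powr (1 / n - 1 / r)) powr q"
      define d where "d = (c powr (1 / r)) powr q"
      have "t0 powr q = d * w"
        unfolding t0_def w_def d_def mult.assoc by (rule powr_mult)
      moreover have "T powr q \<le> s powr q + t0 powr q"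
        by (auto simp: T_def max_def)
      ultimately have "T powr q \<le> s powr q + d * w" by simp
      also have "\<dots> \<le> (1 + d) * (s powr q + w)"
        by (simp add: algebra_simps d_def w_def)
      finally have "T powr q * (V * A) \<le> (1 + d) * (s powr q + w) * (V * A)"
        using V A by (intro mult_right_mono) auto
      then show "T powr q * V * A \<le> C * (s powr q + (G * V powr (1 / n - 1 / r)) powr q) * V"
        by (simp add: C_def w_def[symmetric] d_def[symmetric] mult_ac)
    qed
    finally show ?thesis by (simp add: G_def n_def)
  qed
  ultimately show ?thesis using that by blast
qed

section \<open>Condition L and the choice of the level\<close>

text \<open>With y = - ln \<tau> this turns a power of the logarithm into an arbitrarily small power
  of 1/\<tau>. In the choice of d, the summand 1 also covers A = 0.\<close>

lemma one_plus_powr_le_exp: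
  fixes A \<delta> :: real
  assumes "0 \<le> A" "0 < \<delta>"
  obtains M where "1 \<le> M" "\<And>y. 0 \<le> y \<Longrightarrow> (1 + y) powr A \<le> M * exp (\<delta> * y)"
proof -
  define d where "d = \<delta> / (A + 1)"
  define m where "m = max 1 (1 / d)"
  have d: "0 < d" using assms by (simp add: d_def)
  have m: "1 \<le> m" "1 \<le> m * d"
    using d by (auto simp: m_def max_def field_simps)
  have "(1 + y) powr A \<le> m powr A * exp (\<delta> * y)" if y: "0 \<le> y" for y
  proof -
    have "1 + y \<le> m * (1 + d * y)"
      using m(1) mult_right_mono[OF m(2) y] by (simp add: algebra_simps)
    also have "\<dots> \<le> m * exp (d * y)"
      using m(1) exp_ge_add_one_self[of "d * y"] by (intro mult_left_mono) auto
    finally have "(1 + y) powr A \<le> (m * exp (d * y)) powr A"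
      using y assms by (intro powr_mono2) auto
    also have "\<dots> = m powr A * exp (A * (d * y))"
      by (simp only: powr_mult) (simp add: powr_def)
    also have "\<dots> \<le> m powr A * exp (\<delta> * y)"
    proof -
      have "A * d \<le> \<delta>" using assms by (simp add: d_def field_simps)
      then have "A * (d * y) \<le> \<delta> * y"
        using y by (simp add: mult_right_mono flip: mult.assoc)
      then show ?thesis by (intro mult_left_mono) auto
    qed
    finally show ?thesis .
  qed
  moreover have "1 \<le> m powr A" using m assms by (simp add: ge_one_powr_ge_zero)
  ultimately show ?thesis using that by blast
qed

text \<open>Iterating the defining inequality of Condition L shows that \<open>L\<close> decays at \<open>0\<close> at most like a
  power of the logarithm, hence slower than any power.\<close>

lemma condition_L_slow_decay:
  assumes L: "condition_L L" and \<delta>: "0 < \<delta>"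
  obtains c where "0 < c" "\<And>s \<tau>. 0 < s \<Longrightarrow> 0 < \<tau> \<Longrightarrow> \<tau> \<le> 1 \<Longrightarrow> c * \<tau> powr \<delta> * L s \<le> L (s * \<tau>)"
proof -
  obtain s0 a l0 where s0: "0 < s0" and pos: "\<And>s. 0 < s \<Longrightarrow> 0 < L s" and bdd: "bounded (L ` {0<..})"
    and mono: "mono_on {0<..} L" and a: "0 < a" and l0: "0 < l0"
    and L_le: "\<And>s l. s \<in> {0<..<s0} \<Longrightarrow> l \<in> {0<..<l0} \<Longrightarrow> L s \<le> (1 + a * l) * L (s powr (1 + l))"
    using L unfolding condition_L_def by blast
  have mono': "L x \<le> L y" if "0 < x" "x \<le> y" for x y
    using mono_onD[OF mono, of x y] that by simp
  define l where "l = l0 / 2"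
  define u where "u = 1 + l"
  define b where "b = 1 + a * l"
  \<comment> \<open>Below \<open>S\<close> Condition L applies, and ln s \<le> -1; the latter gives
    s^(1+y) = s e^(y ln s) \<le> s e^(-y), which is s \<tau> for y = - ln \<tau>.\<close>
  define S where "S = min (s0 / 2) (exp (-1))"
  define A where "A = ln b / ln u"
  have l: "0 < l" "l < l0" using l0 by (auto simp: l_def)
  have u: "1 < u" using l by (simp add: u_def)
  have b: "1 < b" using l a by (simp add: b_def)
  have A: "0 \<le> A" using u b by (simp add: A_def)
  have S: "0 < S" "S < s0" "S \<le> exp (-1)" using s0 by (auto simp: S_def)
  obtain M where M: "1 \<le> M" "\<And>y. 0 \<le> y \<Longrightarrow> (1 + y) powr A \<le> M * exp (\<delta> * y)"
    using one_plus_powr_le_exp[OF A \<delta>] by blast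
  have iter: "L s \<le> b ^ k * L (s powr (u ^ k))" if s: "0 < s" "s \<le> S" for s k
  proof (induction k)
    case 0
    then show ?case using s by simp
  next
    case (Suc k)
    have "exp (-1) < (1::real)" by simp
    then have "s \<le> 1" using s S by linarith
    then have "s powr (u ^ k) \<le> s powr 1"
      using s u by (intro powr_mono') auto
    then have "s powr (u ^ k) \<in> {0<..<s0}"
      using s S by auto
    then have "L (s powr (u ^ k)) \<le> b * L ((s powr (u ^ k)) powr u)"
      using L_le[of "s powr (u ^ k)" l] l by (simp add: b_def u_def)
    then have "b ^ k * L (s powr (u ^ k)) \<le> b ^ k * (b * L ((s powr (u ^ k)) powr u))"
      using b by (intro mult_left_mono) auto
    then show ?case
      using Suc by (simp add: powr_powr mult_ac)
  qed
  define c1 where "c1 = 1 / (b * M)"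
  have c1: "0 < c1" "c1 \<le> 1"
    using b M mult_mono[of 1 b 1 M] by (auto simp: c1_def)
  have small: "c1 * \<tau> powr \<delta> * L s \<le> L (s * \<tau>)" if s: "0 < s" "s \<le> S" and \<tau>: "0 < \<tau>" "\<tau> \<le> 1" for s \<tau>
  proof -
    define y where "y = - ln \<tau>"
    have y: "0 \<le> y" using \<tau> by (simp add: y_def)
    \<comment> \<open>The number of iterations needed for u^k \<ge> 1 + y. Rounding up costs at most
      one step, so b^k \<le> b (1 + y)^A, where A is the logarithm of b to base u.\<close>
    define k where "k = nat \<lceil>ln (1 + y) / ln u\<rceil>"
    have k: "ln (1 + y) / ln u \<le> real k" "real k \<le> ln (1 + y) / ln u + 1"
      using y u by (auto simp: k_def of_nat_nat)
    have "1 + y \<le> u ^ k"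
    proof -
      have "ln (1 + y) \<le> real k * ln u" using k(1) u by (simp add: field_simps)
      then have "exp (ln (1 + y)) \<le> exp (real k * ln u)" by simp
      then show ?thesis using y u by (simp add: exp_of_nat_mult)
    qed
    have s1: "ln s \<le> -1"
    proof -
      have "s \<le> exp (-1)" using s S by linarith
      then have "ln s \<le> ln (exp (-1))" using s by (subst ln_le_cancel_iff) auto
      then show ?thesis by simp
    qed
    have "s < 1"
    proof -
      have "exp (-1) < (1::real)" by simp
      then show ?thesis using s S by linarith
    qed
    then have "s powr (u ^ k) \<le> s powr (1 + y)"
      using s \<open>1 + y \<le> u ^ k\<close> by (intro powr_mono') auto
    also have "\<dots> = s * exp (y * ln s)"
      using s unfolding powr_add by (simp add: powr_def)
    also have "\<dots> \<le> s * exp (- y)"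
      using s mult_left_mono[OF s1 y] by simp
    also have "\<dots> = s * \<tau>" using \<tau> by (simp add: y_def)
    finally have "L (s powr (u ^ k)) \<le> L (s * \<tau>)"
      using s by (intro mono') auto
    then have "L s \<le> b ^ k * L (s * \<tau>)"
      by (intro order_trans[OF iter[OF s, of k]] mult_left_mono) (use b in auto)
    also have "b ^ k \<le> b * M * \<tau> powr (- \<delta>)"
    proof -
      have "b ^ k = b powr real k" using b by (simp add: powr_realpow)
      also have "\<dots> \<le> b powr (ln (1 + y) / ln u + 1)"
        using k(2) b by (intro powr_mono) auto
      also have "\<dots> = b * (1 + y) powr A"
        using b y unfolding powr_add by (simp add: powr_def A_def mult.commute)
      also have "\<dots> \<le> b * (M * exp (\<delta> * y))"
        using b y M by (intro mult_left_mono) auto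
      also have "exp (\<delta> * y) = \<tau> powr (- \<delta>)"
        using \<tau> by (simp add: y_def powr_def)
      finally show ?thesis by (simp add: mult_ac)
    qed
    then have "b ^ k * L (s * \<tau>) \<le> b * M * \<tau> powr (- \<delta>) * L (s * \<tau>)"
      using pos[of "s * \<tau>"] s \<tau> by (intro mult_right_mono) auto
    finally have "c1 * \<tau> powr \<delta> * L s \<le> c1 * \<tau> powr \<delta> * (b * M * \<tau> powr (- \<delta>) * L (s * \<tau>))"
      using c1 by (intro mult_left_mono) auto
    also have "\<dots> = (c1 * (b * M)) * (\<tau> powr \<delta> * \<tau> powr (- \<delta>)) * L (s * \<tau>)"
      by (simp add: mult_ac)
    also have "\<dots> = L (s * \<tau>)"
      using b M \<tau> by (simp add: c1_def flip: powr_add)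
    finally show ?thesis .
  qed
  obtain \<Lambda> where "\<forall>x\<in>L ` {0<..}. norm x \<le> \<Lambda>"
    using bdd bounded_iff by blast
  then have \<Lambda>: "L s \<le> \<Lambda>" if "0 < s" for s
    using that by force
  \<comment> \<open>For arguments above \<open>S\<close>, boundedness replaces the iteration:
    \<open>L\<close> exceeds \<open>L S\<close> there by a factor of at most 1/\<kappa>. If s > S
    but s \<tau> < S, the decay is measured from \<open>S\<close> with ratio \<sigma> = s \<tau> / S
    \<ge> \<tau>.\<close>
  define \<kappa> where "\<kappa> = L S / \<Lambda>"
  have "0 < \<Lambda>" using pos[OF S(1)] \<Lambda>[OF S(1)] by linarith
  then have \<kappa>: "0 < \<kappa>" "\<And>s. 0 < s \<Longrightarrow> \<kappa> * L s \<le> L S" "\<kappa> \<le> 1"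
    using pos[OF S(1)] \<Lambda>[OF S(1)] \<Lambda> by (auto simp: \<kappa>_def divide_simps mult_left_mono)
  have "c1 * \<kappa> * \<tau> powr \<delta> * L s \<le> L (s * \<tau>)" if s: "0 < s" and \<tau>: "0 < \<tau>" "\<tau> \<le> 1" for s \<tau>
  proof -
    have \<tau>1: "\<tau> powr \<delta> \<le> 1" using \<tau> \<delta> by (simp add: powr_le1)
    consider "s \<le> S" | "S < s" "S \<le> s * \<tau>" | "S < s" "s * \<tau> < S" by linarith
    then show ?thesis
    proof cases
      case 1
      have "c1 * \<kappa> * \<tau> powr \<delta> * L s \<le> c1 * 1 * \<tau> powr \<delta> * L s"
        using \<kappa> c1 pos[OF s] by (intro mult_right_mono mult_left_mono) auto
      also have "\<dots> \<le> L (s * \<tau>)" using small[OF s 1 \<tau>] by simp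
      finally show ?thesis .
    next
      case 2
      have "(c1 * \<tau> powr \<delta>) * (\<kappa> * L s) \<le> 1 * L S"
        using c1 \<tau>1 \<kappa> pos[OF s] s by (intro mult_mono mult_le_one) auto
      also have "\<dots> \<le> L (s * \<tau>)" using 2 S by (simp add: mono')
      finally show ?thesis by (simp add: mult_ac)
    next
      case 3
      define \<sigma> where "\<sigma> = s * \<tau> / S"
      have \<sigma>: "\<tau> \<le> \<sigma>" "\<sigma> \<le> 1" "S * \<sigma> = s * \<tau>"
        using 3 \<tau> S by (auto simp: \<sigma>_def field_simps)
      have "(c1 * \<tau> powr \<delta>) * (\<kappa> * L s) \<le> (c1 * \<sigma> powr \<delta>) * L S"
        using c1 \<kappa> pos[OF s] s \<sigma> \<tau> \<delta> by (intro mult_mono mult_left_mono powr_mono2) auto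
      also have "\<dots> \<le> L (S * \<sigma>)"
        using small[of S \<sigma>] S \<sigma> \<tau> by simp
      finally show ?thesis using \<sigma> by (simp add: mult_ac)
    qed
  qed
  moreover have "0 < c1 * \<kappa>" using c1 \<kappa> by simp
  ultimately show ?thesis using that by blast
qed

lemma sublevel_powr_le:
  assumes c: "0 < c" and slow: "\<And>s \<tau>. 0 < s \<Longrightarrow> 0 < \<tau> \<Longrightarrow> \<tau> \<le> 1 \<Longrightarrow> c * \<tau> powr \<delta> * L s \<le> L (s * \<tau>)"
    and q: "\<delta> \<le> q" and s: "0 < s" "0 < L s" and t: "0 < t" "t \<le> s"
  shows "t powr q \<le> s powr q / (c * L s) * (L t :: real)"
proof -
  define \<tau> where "\<tau> = t / s"
  have \<tau>: "0 < \<tau>" "\<tau> \<le> 1" "t = s * \<tau>" using s t by (auto simp: \<tau>_def)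
  have "c * L s * \<tau> powr q \<le> c * L s * \<tau> powr \<delta>"
    using \<tau> q c s by (intro mult_left_mono powr_mono') auto
  also have "\<dots> \<le> L t"
    using slow[OF s(1) \<tau>(1,2)] by (simp add: \<tau>(3) mult_ac)
  finally have "\<tau> powr q \<le> L t / (c * L s)"
    using c s by (simp add: field_simps)
  then have "s powr q * \<tau> powr q \<le> s powr q * (L t / (c * L s))"
    by (intro mult_left_mono) auto
  then show ?thesis using \<tau> s by (simp add: powr_mult)
qed

text \<open>Each summand is at most (x + y)^q by monotonicity, so the constant 2 serves every q > 0,
  below and above 1 alike.\<close>

lemma powr_add_powr_le:
  fixes x y q :: real
  assumes "0 \<le> x" "0 \<le> y" "0 < q"
  shows "x powr q + y powr q \<le> 2 * (x + y) powr q"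
  using powr_mono2[of q x "x + y"] powr_mono2[of q y "x + y"] assms by simp

section \<open>Choice of the cutting level\<close>

lemma optimal_level_bound:
  fixes L :: "real \<Rightarrow> real" and q \<nu> \<epsilon> :: real
  assumes L: "condition_L L" and q: "0 < q" and \<nu>: "0 < \<nu>" and \<epsilon>: "0 < \<epsilon>"
  obtains C where "0 < C"
    "\<And>G K. 0 < G \<Longrightarrow> 0 < K \<Longrightarrow> \<exists>s>0. s * (K / L s) powr (1 / q) + G * (K / L s) powr \<nu>
        \<le> C * (1 + (1 + K powr \<epsilon>) * K powr \<nu>) * G * L (G\<^sup>2) powr (- \<nu>)"
proof -
  \<comment> \<open>\<delta> \<le> q/2 keeps the losses of slow decay below half a power of
    \<open>m\<close> and of \<tau>. The other bound ensures that \<tau>^(-\<delta> \<nu>), at \<tau>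
    = K^(-2/q), is at most K^\<epsilon> for K \<ge> 1; this is the source of \<epsilon> in the
    claim.\<close>
  define \<delta> where "\<delta> = min (q / 2) (\<epsilon> * q / (2 * \<nu>))"
  have \<delta>: "0 < \<delta>" "\<delta> \<le> q / 2" "\<delta> * \<nu> * (2 / q) \<le> \<epsilon>"
  proof -
    show "0 < \<delta>" "\<delta> \<le> q / 2" using q \<nu> \<epsilon> by (auto simp: \<delta>_def)
    have "\<delta> \<le> \<epsilon> * q / (2 * \<nu>)" by (simp add: \<delta>_def)
    then show "\<delta> * \<nu> * (2 / q) \<le> \<epsilon>" using q \<nu> by (simp add: field_simps)
  qed
  obtain c where c: "0 < c"
    and slow: "\<And>s \<tau>. 0 < s \<Longrightarrow> 0 < \<tau> \<Longrightarrow> \<tau> \<le> 1 \<Longrightarrow> c * \<tau> powr \<delta> * L s \<le> L (s * \<tau>)"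
    using condition_L_slow_decay[OF L \<delta>(1)] by blast
  have pos: "\<And>s. 0 < s \<Longrightarrow> 0 < L s" and bdd: "bounded (L ` {0<..})" and mono: "mono_on {0<..} L"
    using L unfolding condition_L_def by blast+
  obtain \<Lambda> where "\<forall>x\<in>L ` {0<..}. norm x \<le> \<Lambda>"
    using bdd bounded_iff by blast
  then have \<Lambda>: "L s \<le> \<Lambda>" if "0 < s" for s
    using that by force
  have L1: "0 < L 1" using pos by simp
  have \<Lambda>0: "0 < \<Lambda>" using L1 \<Lambda>[of 1] by simp
  \<comment> \<open>Compares \<open>L (min 1 (G\<^sup>2))\<close> with \<open>L (G\<^sup>2)\<close>:
    for G > 1 the former is \<open>L 1\<close>, and the latter is at most \<Lambda>.\<close>
  define c0 where "c0 = L 1 / \<Lambda>"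
  have c0: "0 < c0" "c0 \<le> 1" using L1 \<Lambda>0 \<Lambda>[of 1] by (auto simp: c0_def)
  \<comment> \<open>One summand for each sign of \<nu> - 1/q: a nonnegative power of
    \<open>L m\<close> is bounded through \<Lambda>, a negative one through the slow decay of
    \<open>L\<close> from 1 down to \<open>m\<close>.\<close>
  define C2 where "C2 = \<Lambda> powr (\<nu> - 1 / q) + (c * L 1) powr (\<nu> - 1 / q)"
  define C where "C = c powr (- (1 / q)) * C2 * c0 powr (- \<nu>) + (c * c0) powr (- \<nu>)"
  have C2: "0 < C2" using \<Lambda>0 by (auto simp: C2_def intro!: add_pos_nonneg)
  have C: "0 < C" unfolding C_def using C2 c c0 by (intro add_pos_nonneg mult_pos_pos) auto
  have main: "\<exists>s>0. s * (K / L s) powr (1 / q) + G * (K / L s) powr \<nu>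
        \<le> C * (1 + (1 + K powr \<epsilon>) * K powr \<nu>) * G * L (G\<^sup>2) powr (- \<nu>)" if G: "0 < G" and K: "0 < K" for G K
  proof -
    \<comment> \<open>Both factors of the level s = m \<tau> are spent in halves. One m^(1/2) is at
      most G and supplies the gradient norm, the other absorbs L(m)^(\<nu> - 1/q). One \<tau>^(1/2)
      compensates K^(1/q), the other absorbs \<tau>^(-\<delta>/q), the loss in passing from L(m) to
      L(s).\<close>
    define m where "m = min 1 (G\<^sup>2)"
    define \<tau> where "\<tau> = min 1 (K powr (- (2 / q)))"
    define s where "s = m * \<tau>"
    have m: "0 < m" "m \<le> 1" "m \<le> G\<^sup>2" using G by (auto simp: m_def)
    have \<tau>: "0 < \<tau>" "\<tau> \<le> 1" using K by (auto simp: \<tau>_def)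
    have s: "0 < s" using m \<tau> by (simp add: s_def)
    have G2: "0 < L (G\<^sup>2)" using pos G by simp
    have LG: "c0 * L (G\<^sup>2) \<le> L m"
    proof (cases "G\<^sup>2 \<le> 1")
      case True
      then show ?thesis using c0 G2 by (simp add: m_def mult_left_le_one_le)
    next
      case False
      then show ?thesis using \<Lambda>[of "G\<^sup>2"] G \<Lambda>0 L1 by (simp add: m_def c0_def field_simps mult_left_mono)
    qed
    have Lm: "0 < L m" and Ls: "0 < L s" using pos m s by auto
    have Ls_ge: "c * \<tau> powr \<delta> * L m \<le> L s"
      using slow[OF m(1) \<tau>] by (simp add: s_def)
    have cases_K: "K \<le> 1 \<and> \<tau> = 1 \<or> 1 \<le> K \<and> \<tau> = K powr (- (2 / q))"
    proof (cases "K \<le> 1")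
      case True
      then have "1 powr (- (2 / q)) \<le> K powr (- (2 / q))"
        using K q by (intro powr_mono2') auto
      then show ?thesis using True by (simp add: \<tau>_def)
    next
      case False
      then have "K powr (- (2 / q)) \<le> 1 powr (- (2 / q))"
        using K q by (intro powr_mono2') auto
      then show ?thesis using False by (simp add: \<tau>_def)
    qed
    have m_bound: "m powr (1 / 2) * L m powr (\<nu> - 1 / q) \<le> C2"
    proof (cases "1 / q \<le> \<nu>")
      case True
      have "m powr (1 / 2) * L m powr (\<nu> - 1 / q) \<le> 1 * \<Lambda> powr (\<nu> - 1 / q)"
        using m Lm True \<Lambda> by (intro mult_mono powr_mono2 powr_le1) auto
      also have "\<dots> \<le> C2" by (simp add: C2_def)
      finally show ?thesis .
    next
      case False
      have "c * m powr \<delta> * L 1 \<le> L m" using slow[of 1 m] m by simp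
      then have "L m powr (\<nu> - 1 / q) \<le> (c * m powr \<delta> * L 1) powr (\<nu> - 1 / q)"
        using False c m L1 by (intro powr_mono2') auto
      also have "\<dots> = (c * L 1) powr (\<nu> - 1 / q) * m powr (- (\<delta> * (1 / q - \<nu>)))"
        using c m L1 by (simp add: powr_mult powr_powr algebra_simps)
      finally have "m powr (1 / 2) * L m powr (\<nu> - 1 / q)
          \<le> m powr (1 / 2) * ((c * L 1) powr (\<nu> - 1 / q) * m powr (- (\<delta> * (1 / q - \<nu>))))"
        by (intro mult_left_mono) auto
      also have "\<dots> = (c * L 1) powr (\<nu> - 1 / q) * m powr (1 / 2 - \<delta> * (1 / q - \<nu>))"
        unfolding mult.left_commute[of "m powr (1 / 2)"] by (simp flip: powr_add)
      also have "\<dots> \<le> (c * L 1) powr (\<nu> - 1 / q) * 1"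
      proof (intro mult_left_mono powr_le1)
        have "\<delta> * (1 / q - \<nu>) \<le> (q / 2) * (1 / q)"
          using \<delta> False \<nu> q by (intro mult_mono) auto
        then show "0 \<le> 1 / 2 - \<delta> * (1 / q - \<nu>)" using q by simp
      qed (use m in auto)
      also have "\<dots> \<le> C2" by (simp add: C2_def)
      finally show ?thesis .
    qed
    have "L s powr (- (1 / q)) \<le> (c * \<tau> powr \<delta> * L m) powr (- (1 / q))"
      using Ls_ge c \<tau> Lm q by (intro powr_mono2') auto
    also have "\<dots> = c powr (- (1 / q)) * \<tau> powr (- (\<delta> / q)) * L m powr (- (1 / q))"
      using c \<tau> Lm by (simp add: powr_mult powr_powr)
    finally have Ls_inv: "L s powr (- (1 / q)) \<le> c powr (- (1 / q)) * \<tau> powr (- (\<delta> / q)) * L m powr (- (1 / q))" .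
    have \<tau>K: "\<tau> powr (1 - \<delta> / q) * K powr (1 / q) \<le> 1"
    proof -
      have "1 / 2 \<le> 1 - \<delta> / q" using \<delta> q by (simp add: field_simps)
      then have "\<tau> powr (1 - \<delta> / q) \<le> \<tau> powr (1 / 2)"
        using \<tau> by (intro powr_mono') auto
      then have "\<tau> powr (1 - \<delta> / q) * K powr (1 / q) \<le> \<tau> powr (1 / 2) * K powr (1 / q)"
        by (intro mult_right_mono) auto
      also have "\<dots> \<le> 1"
        using cases_K
      proof
        assume "K \<le> 1 \<and> \<tau> = 1"
        then show ?thesis using K q by (simp add: powr_le1)
      next
        assume "1 \<le> K \<and> \<tau> = K powr (- (2 / q))"
        then show ?thesis using K by (simp add: powr_powr flip: powr_add)
      qed
      finally show ?thesis .
    qed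
    have Lm_inv: "L m powr (- \<nu>) \<le> c0 powr (- \<nu>) * L (G\<^sup>2) powr (- \<nu>)"
    proof -
      have "L m powr (- \<nu>) \<le> (c0 * L (G\<^sup>2)) powr (- \<nu>)"
        using LG c0 G2 \<nu> by (intro powr_mono2') auto
      then show ?thesis by (simp add: powr_mult)
    qed
    have mG: "m powr (1 / 2) \<le> G"
    proof -
      have "m powr (1 / 2) \<le> (G\<^sup>2) powr (1 / 2)"
        using m by (intro powr_mono2) auto
      then show ?thesis using G by (simp add: powr_half_sqrt)
    qed
    have first: "s * (K / L s) powr (1 / q) \<le> c powr (- (1 / q)) * C2 * c0 powr (- \<nu>) * (G * L (G\<^sup>2) powr (- \<nu>))"
    proof -
      have "s * (K / L s) powr (1 / q) = m * \<tau> * K powr (1 / q) * L s powr (- (1 / q))"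
        using K Ls unfolding powr_divide powr_minus by (simp add: s_def divide_inverse)
      also have "\<dots> \<le> m * \<tau> * K powr (1 / q) * (c powr (- (1 / q)) * \<tau> powr (- (\<delta> / q)) * L m powr (- (1 / q)))"
        using m \<tau> by (intro mult_left_mono Ls_inv) auto
      also have "\<dots> = (c powr (- (1 / q)) * (m * L m powr (- (1 / q)))) * (\<tau> powr (1 - \<delta> / q) * K powr (1 / q))"
        using \<tau> by (simp add: powr_diff powr_minus field_simps)
      also have "\<dots> \<le> (c powr (- (1 / q)) * (m * L m powr (- (1 / q)))) * 1"
        using m by (intro mult_left_mono \<tau>K) auto
      also have "\<dots> = c powr (- (1 / q)) * ((m powr (1 / 2) * L m powr (\<nu> - 1 / q)) * (m powr (1 / 2) * L m powr (- \<nu>)))"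
      proof -
        have "m = m powr (1 / 2) * m powr (1 / 2)"
          using m by (simp flip: powr_add)
        moreover have "L m powr (- (1 / q)) = L m powr (\<nu> - 1 / q) * L m powr (- \<nu>)"
          by (simp flip: powr_add)
        ultimately have "m * L m powr (- (1 / q)) = (m powr (1 / 2) * m powr (1 / 2)) * (L m powr (\<nu> - 1 / q) * L m powr (- \<nu>))"
          by (rule arg_cong2)
        then show ?thesis by (simp only: mult_ac mult_1_right)
      qed
      also have "\<dots> \<le> c powr (- (1 / q)) * (C2 * (G * (c0 powr (- \<nu>) * L (G\<^sup>2) powr (- \<nu>))))"
        using C2 G by (intro mult_left_mono mult_mono m_bound mG Lm_inv) auto
      finally show ?thesis by (simp add: mult_ac)
    qed
    have second: "G * (K / L s) powr \<nu> \<le> (c * c0) powr (- \<nu>) * ((1 + K powr \<epsilon>) * K powr \<nu>) * (G * L (G\<^sup>2) powr (- \<nu>))"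
    proof -
      have "c * \<tau> powr \<delta> * (c0 * L (G\<^sup>2)) \<le> c * \<tau> powr \<delta> * L m"
        using c by (intro mult_left_mono LG) auto
      then have "c * \<tau> powr \<delta> * (c0 * L (G\<^sup>2)) \<le> L s"
        using Ls_ge by (rule order_trans)
      then have "L s powr (- \<nu>) \<le> (c * \<tau> powr \<delta> * (c0 * L (G\<^sup>2))) powr (- \<nu>)"
        using c \<tau> c0 G2 \<nu> by (intro powr_mono2') auto
      also have "\<dots> = (c * c0) powr (- \<nu>) * \<tau> powr (- (\<delta> * \<nu>)) * L (G\<^sup>2) powr (- \<nu>)"
        by (simp add: powr_mult powr_powr mult_ac)
      also have "\<dots> \<le> (c * c0) powr (- \<nu>) * (1 + K powr \<epsilon>) * L (G\<^sup>2) powr (- \<nu>)"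
      proof (intro mult_right_mono mult_left_mono)
        show "\<tau> powr (- (\<delta> * \<nu>)) \<le> 1 + K powr \<epsilon>"
          using cases_K
        proof
          assume K1: "1 \<le> K \<and> \<tau> = K powr (- (2 / q))"
          then have "\<tau> powr (- (\<delta> * \<nu>)) = K powr (\<delta> * \<nu> * (2 / q))"
            by (simp add: powr_powr mult_ac)
          also have "\<dots> \<le> K powr \<epsilon>"
            using K1 \<delta> by (intro powr_mono) auto
          finally show ?thesis by simp
        qed simp
      qed auto
      finally have "G * K powr \<nu> * L s powr (- \<nu>) \<le> G * K powr \<nu> * ((c * c0) powr (- \<nu>) * (1 + K powr \<epsilon>) * L (G\<^sup>2) powr (- \<nu>))"
        using G by (intro mult_left_mono) auto
      moreover have "(K / L s) powr \<nu> = K powr \<nu> * L s powr (- \<nu>)"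
        using K Ls unfolding powr_divide powr_minus by (simp add: divide_inverse)
      ultimately show ?thesis by (simp add: mult_ac)
    qed
    define X where "X = G * L (G\<^sup>2) powr (- \<nu>)"
    define Y where "Y = (1 + K powr \<epsilon>) * K powr \<nu>"
    define C1 where "C1 = c powr (- (1 / q)) * C2 * c0 powr (- \<nu>)"
    define C3 where "C3 = (c * c0) powr (- \<nu>)"
    have nn: "0 \<le> X" "0 \<le> Y" "0 \<le> C1" "0 \<le> C3"
      using G C2 by (auto simp: X_def Y_def C1_def C3_def)
    have "s * (K / L s) powr (1 / q) + G * (K / L s) powr \<nu> \<le> C1 * X + C3 * Y * X"
      using first second by (simp add: X_def Y_def C1_def C3_def)
    also have "\<dots> \<le> (C1 + C3) * (1 + Y) * X"
      using nn by (simp add: algebra_simps)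
    finally show ?thesis
      using s by (intro exI[of _ s]) (simp add: X_def Y_def C1_def C3_def C_def mult_ac)
  qed
  show ?thesis using that[OF C] main by blast
qed

section \<open>Assembling the norm estimate\<close>

text \<open>Where \<phi> vanishes the integrand is \<open>L 0\<close>, while Condition L states
  positivity on the open half-line; continuity from the right fills the gap.\<close>

lemma condition_L_zero_nonneg:
  assumes "condition_L L"
  shows "0 \<le> L 0"
proof -
  have pos: "\<And>s. 0 < s \<Longrightarrow> 0 < L s" and cont: "continuous_on {0..} L"
    using assms unfolding condition_L_def by blast+
  have "(L \<longlongrightarrow> L 0) (at 0 within {0..})"
    using cont by (simp add: continuous_on)
  then have "(L \<longlongrightarrow> L 0) (at_right 0)"
    by (rule tendsto_within_subset) auto
  moreover have "\<forall>\<^sub>F x in at_right 0. 0 \<le> L x"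
    using eventually_at_right_less[of "0::real"] by eventually_elim (simp add: pos less_imp_le)
  ultimately show ?thesis by (rule tendsto_lowerbound) simp
qed

text \<open>With gradient norm 0 the doubling inequality makes every set {\<phi> > 2t} null, so
  \<phi> = 0 almost everywhere. Finiteness of the level sets is what excludes nonzero constants.
  Positivity is needed because the cutting level is built from the gradient norm.\<close>

lemma sobolev_gradient_norm_pos:
  fixes \<phi> :: "real^'n \<Rightarrow> real"
  assumes \<phi>: "\<phi> \<in> sobolev_W1 r" and grad: "has_weak_gradient \<phi> grad" and r: "1 \<le> r"
    and fin: "\<And>t. 0 < t \<Longrightarrow> emeasure lebesgue {x. t < \<phi> x} < \<infinity>"
    and nonneg: "AE x in lebesgue. 0 \<le> \<phi> x" and nz: "\<not> (AE x in lebesgue. \<phi> x = 0)"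
  shows "0 < Lq_norm r grad"
proof (rule ccontr)
  assume "\<not> 0 < Lq_norm r grad"
  then have G: "Lq_norm r grad = 0"
    by (simp add: Lq_norm_def)
  have [measurable]: "\<phi> \<in> borel_measurable lebesgue"
    using \<phi> by (simp add: sobolev_W1_def Lq_space_def)
  have "AE x in lebesgue. \<phi> x \<le> 2 * t" if t: "0 < t" for t
  proof -
    have "{x \<in> space lebesgue. 2 * t < \<phi> x} \<in> sets lebesgue" by measurable
    moreover have "measure lebesgue {x. 2 * t < \<phi> x} = 0"
    proof -
      have "t powr r * measure lebesgue {x. 2 * t < \<phi> x} \<le> 0"
        using sobolev_level_set_doubling[OF \<phi> grad r t fin[OF t]] G r by simp
      then have "measure lebesgue {x. 2 * t < \<phi> x} \<le> 0"
        using t by (simp add: mult_le_0_iff)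
      then show ?thesis by (simp add: measure_le_0_iff)
    qed
    moreover have "emeasure lebesgue {x. 2 * t < \<phi> x} = ennreal (measure lebesgue {x. 2 * t < \<phi> x})"
      using fin[of "2 * t"] t by (intro emeasure_eq_ennreal_measure) simp
    ultimately have "{x. 2 * t < \<phi> x} \<in> null_sets lebesgue"
      by (intro null_setsI) simp_all
    from AE_not_in[OF this] show ?thesis
      by eventually_elim simp
  qed
  from this[of "1 / real (Suc k)" for k] have "AE x in lebesgue. \<phi> x \<le> 2 * (1 / real (Suc k))" for k
    by simp
  then have "AE x in lebesgue. \<forall>k. \<phi> x \<le> 2 * (1 / real (Suc k))"
    by (subst AE_all_countable) blast
  then have "AE x in lebesgue. \<phi> x = 0"
    using nonneg
  proof eventually_elim
    case (elim x)
    have "(\<lambda>k. 2 * (1 / real (Suc k))) \<longlonglongrightarrow> 2 * 0"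
      by (intro tendsto_intros LIMSEQ_Suc lim_1_over_n)
    then have "\<phi> x \<le> 2 * 0"
      by (rule LIMSEQ_le_const) (use elim in auto)
    then show ?case using elim by simp
  qed
  then show False using nz by contradiction
qed

lemma sobolev_norm_bound:
  fixes L :: "real \<Rightarrow> real" and r q \<nu> :: real
  assumes L: "condition_L L" and r: "1 \<le> r" and q: "0 < q"
    and sub: "r < real CARD('n) \<Longrightarrow> q < r * real CARD('n) / (real CARD('n) - r)"
    and \<nu>: "\<nu> = 1 / q - (real CARD('n) - r) / (r * real CARD('n))"
  obtains C where "0 < C"
    "\<And>(\<phi> :: real^'n \<Rightarrow> real) grad s. \<phi> \<in> sobolev_W1 r \<Longrightarrow> has_weak_gradient \<phi> grad \<Longrightarrow>
      (AE x in lebesgue. 0 \<le> \<phi> x) \<Longrightarrow> integrable lebesgue (\<lambda>x. L (\<phi> x)) \<Longrightarrow>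
      0 < (LINT x|lebesgue. L (\<phi> x)) \<Longrightarrow> 0 < s \<Longrightarrow>
      emeasure lebesgue {x. s < \<phi> x} \<le> ennreal ((LINT x|lebesgue. L (\<phi> x)) / L s) \<Longrightarrow>
      \<phi> \<in> Lq_space q \<and>
      Lq_norm q \<phi> \<le> C * (s * ((LINT x|lebesgue. L (\<phi> x)) / L s) powr (1 / q)
        + Lq_norm r grad * ((LINT x|lebesgue. L (\<phi> x)) / L s) powr \<nu>)"
proof -
  \<comment> \<open>Slow decay with exponent \<open>q\<close> itself gives the domination of
    \<phi>^q by L(\<phi>) below the level.\<close>
  obtain c where c: "0 < c"
    and slow: "\<And>s \<tau>. 0 < s \<Longrightarrow> 0 < \<tau> \<Longrightarrow> \<tau> \<le> 1 \<Longrightarrow> c * \<tau> powr q * L s \<le> L (s * \<tau>)"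
    using condition_L_slow_decay[OF L q] by blast
  obtain C1 where C1: "0 < C1"
    and super: "\<And>(\<phi> :: real^'n \<Rightarrow> real) grad s V. \<phi> \<in> sobolev_W1 r \<Longrightarrow> has_weak_gradient \<phi> grad \<Longrightarrow> 0 < s \<Longrightarrow> 0 < V \<Longrightarrow>
      emeasure lebesgue {x. s < \<phi> x} \<le> ennreal V \<Longrightarrow>
      (\<integral>\<^sup>+x. ennreal (\<phi> x powr q) * indicator {x. s < \<phi> x} x \<partial>lebesgue)
        \<le> ennreal (C1 * (s powr q + (Lq_norm r grad * V powr (1 / real CARD('n) - 1 / r)) powr q) * V)"
    using sobolev_superlevel_bound[OF r q sub] by blast
  have pos: "\<And>s. 0 < s \<Longrightarrow> 0 < L s"
    using L unfolding condition_L_def by blast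
  have L0: "0 \<le> L 0" by (rule condition_L_zero_nonneg[OF L])
  define D where "D = 1 / c + C1"
  have D: "0 < D" using c C1 by (simp add: D_def add_pos_pos)
  have "0 < (2 * D) powr (1 / q)" using D by simp
  moreover have "\<phi> \<in> Lq_space q \<and>
      Lq_norm q \<phi> \<le> (2 * D) powr (1 / q) * (s * ((LINT x|lebesgue. L (\<phi> x)) / L s) powr (1 / q)
        + Lq_norm r grad * ((LINT x|lebesgue. L (\<phi> x)) / L s) powr \<nu>)"
    if \<phi>: "\<phi> \<in> sobolev_W1 r" and grad: "has_weak_gradient \<phi> grad" and nonneg: "AE x in lebesgue. 0 \<le> \<phi> x"
      and int: "integrable lebesgue (\<lambda>x. L (\<phi> x))" and K: "0 < (LINT x|lebesgue. L (\<phi> x))" and s: "0 < s"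
      and em: "emeasure lebesgue {x. s < \<phi> x} \<le> ennreal ((LINT x|lebesgue. L (\<phi> x)) / L s)"
    for \<phi> :: "real^'n \<Rightarrow> real" and grad s
  proof -
    define K where "K = (LINT x|lebesgue. L (\<phi> x))"
    define V where "V = K / L s"
    define G where "G = Lq_norm r grad"
    have Ls: "0 < L s" using pos s by simp
    have V: "0 < V" using K Ls by (simp add: V_def K_def)
    have G: "0 \<le> G" by (simp add: G_def Lq_norm_def)
    have \<phi>m [measurable]: "\<phi> \<in> borel_measurable lebesgue"
      using \<phi> by (simp add: sobolev_W1_def Lq_space_def)
    have Sm [measurable]: "{x. s < \<phi> x} \<in> sets lebesgue"
    proof -
      have "{x \<in> space lebesgue. s < \<phi> x} \<in> sets lebesgue" by measurable
      then show ?thesis by simp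
    qed
    have Lnn: "AE x in lebesgue. 0 \<le> L (\<phi> x)"
      using nonneg by eventually_elim (metis L0 less_eq_real_def pos)
    define W where "W = (s * V powr (1 / q)) powr q + (G * V powr \<nu>) powr q"
    \<comment> \<open>The estimate is made for the extended nonnegative integral, so that membership
      in \<open>Lq_space q\<close> is a result and the Bochner integral is meaningful
      afterwards.\<close>
    have "(\<integral>\<^sup>+x. ennreal (\<bar>\<phi> x\<bar> powr q) \<partial>lebesgue)
      \<le> (\<integral>\<^sup>+x. ennreal (s powr q / (c * L s) * L (\<phi> x)) + ennreal (\<phi> x powr q) * indicator {x. s < \<phi> x} x \<partial>lebesgue)"
    proof (rule nn_integral_mono_AE)
      show "AE x in lebesgue. ennreal (\<bar>\<phi> x\<bar> powr q)
        \<le> ennreal (s powr q / (c * L s) * L (\<phi> x)) + ennreal (\<phi> x powr q) * indicator {x. s < \<phi> x} x"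
        using nonneg
      proof eventually_elim
        case (elim x)
        consider "\<phi> x = 0" | "0 < \<phi> x" "\<phi> x \<le> s" | "s < \<phi> x"
          using elim by linarith
        then show ?case
        proof cases
          case 2
          then have "\<bar>\<phi> x\<bar> powr q \<le> s powr q / (c * L s) * L (\<phi> x)"
            using sublevel_powr_le[OF c slow order_refl s Ls, of "\<phi> x"] by simp
          then have "ennreal (\<bar>\<phi> x\<bar> powr q) \<le> ennreal (s powr q / (c * L s) * L (\<phi> x))"
            by (rule ennreal_leI)
          then show ?thesis by (rule order_trans) simp
        qed (use s in auto)
      qed
    qed
    also have "\<dots> = (\<integral>\<^sup>+x. ennreal (s powr q / (c * L s) * L (\<phi> x)) \<partial>lebesgue)
        + (\<integral>\<^sup>+x. ennreal (\<phi> x powr q) * indicator {x. s < \<phi> x} x \<partial>lebesgue)"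
    proof (rule nn_integral_add)
      have [measurable]: "(\<lambda>x. L (\<phi> x)) \<in> borel_measurable lebesgue"
        using int by (rule borel_measurable_integrable)
      show "(\<lambda>x. ennreal (s powr q / (c * L s) * L (\<phi> x))) \<in> borel_measurable lebesgue"
        by measurable
    qed measurable
    also have "\<dots> \<le> ennreal (1 / c * s powr q * V)
        + ennreal (C1 * (s powr q + (G * V powr (1 / real CARD('n) - 1 / r)) powr q) * V)"
    proof (rule add_mono)
      have "(\<integral>\<^sup>+x. ennreal (s powr q / (c * L s) * L (\<phi> x)) \<partial>lebesgue)
          = ennreal (LINT x|lebesgue. s powr q / (c * L s) * L (\<phi> x))"
        using int Lnn c Ls by (intro nn_integral_eq_integral) (auto elim!: eventually_mono)
      also have "(LINT x|lebesgue. s powr q / (c * L s) * L (\<phi> x)) = 1 / c * s powr q * V"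
        by (simp add: V_def K_def)
      finally show "(\<integral>\<^sup>+x. ennreal (s powr q / (c * L s) * L (\<phi> x)) \<partial>lebesgue) \<le> ennreal (1 / c * s powr q * V)"
        by simp
      show "(\<integral>\<^sup>+x. ennreal (\<phi> x powr q) * indicator {x. s < \<phi> x} x \<partial>lebesgue)
        \<le> ennreal (C1 * (s powr q + (G * V powr (1 / real CARD('n) - 1 / r)) powr q) * V)"
        using super[OF \<phi> grad s V] em by (simp add: V_def K_def G_def)
    qed
    also have "\<dots> = ennreal (1 / c * s powr q * V + C1 * (s powr q + (G * V powr (1 / real CARD('n) - 1 / r)) powr q) * V)"
      using c C1 V by (intro ennreal_plus[symmetric]) auto
    also have "\<dots> \<le> ennreal (D * W)"
    proof (rule ennreal_leI)
      have "s powr q * V = (s * V powr (1 / q)) powr q"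
        using V q by (simp add: powr_mult powr_powr)
      \<comment> \<open>The exponents match because (1/n - 1/r) q + 1 = \<nu> q, which is how \<nu>
        arises.\<close>
      moreover have "(G * V powr (1 / real CARD('n) - 1 / r)) powr q * V = (G * V powr \<nu>) powr q"
      proof -
        have "\<nu> = 1 / q + (1 / real CARD('n) - 1 / r)"
          using r by (simp add: \<nu> field_simps)
        then have "(1 / real CARD('n) - 1 / r) * q + 1 = \<nu> * q"
          using q by (simp add: field_simps)
        then have "V powr ((1 / real CARD('n) - 1 / r) * q) * V = V powr (\<nu> * q)"
          using V by (metis less_eq_real_def powr_add powr_one)
        then show ?thesis by (simp add: powr_mult powr_powr mult.assoc)
      qed
      ultimately have "1 / c * s powr q * V + C1 * (s powr q + (G * V powr (1 / real CARD('n) - 1 / r)) powr q) * V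
          = 1 / c * (s * V powr (1 / q)) powr q + C1 * W"
        by (simp add: W_def algebra_simps)
      also have "\<dots> \<le> 1 / c * W + C1 * W"
        using c by (intro add_right_mono mult_left_mono) (auto simp: W_def)
      finally show "1 / c * s powr q * V + C1 * (s powr q + (G * V powr (1 / real CARD('n) - 1 / r)) powr q) * V \<le> D * W"
        by (simp add: D_def algebra_simps)
    qed
    finally have nn: "(\<integral>\<^sup>+x. ennreal (\<bar>\<phi> x\<bar> powr q) \<partial>lebesgue) \<le> ennreal (D * W)" .
    have intq: "integrable lebesgue (\<lambda>x. \<bar>\<phi> x\<bar> powr q)"
      by (rule integrableI_nonneg) (auto intro: le_less_trans[OF nn])
    then have mem: "\<phi> \<in> Lq_space q" by (simp add: Lq_space_def)
    have "(LINT x|lebesgue. \<bar>\<phi> x\<bar> powr q) \<le> D * W"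
    proof -
      have "ennreal (LINT x|lebesgue. \<bar>\<phi> x\<bar> powr q) \<le> ennreal (D * W)"
        using nn by (subst nn_integral_eq_integral[symmetric, OF intq]) auto
      then show ?thesis using D by (subst (asm) ennreal_le_iff) (auto simp: W_def)
    qed
    then have "Lq_norm q \<phi> \<le> (D * W) powr (1 / q)"
      using q by (simp add: Lq_norm_def powr_mono2)
    also have "\<dots> \<le> (2 * D * (s * V powr (1 / q) + G * V powr \<nu>) powr q) powr (1 / q)"
      using D q s G powr_add_powr_le[of "s * V powr (1 / q)" "G * V powr \<nu>" q]
      by (intro powr_mono2) (auto simp: W_def)
    also have "\<dots> = (2 * D) powr (1 / q) * (s * V powr (1 / q) + G * V powr \<nu>)"
      using s G q by (simp add: powr_mult powr_powr)
    finally show ?thesis using mem by (simp add: V_def K_def G_def)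
  qed
  ultimately show ?thesis using that by blast
qed

theorem theorem1p2:
  fixes L :: "real \<Rightarrow> real" and r q \<nu> :: real
  assumes "condition_L L"
    and "1 \<le> r"
    and "0 < q"
    and "r < real CARD('n) \<Longrightarrow> q < r * real CARD('n) / (real CARD('n) - r)"
    and "\<nu> = 1 / q - (real CARD('n) - r) / (r * real CARD('n))"
  shows "\<forall>\<epsilon>>0. \<exists>C>0. \<forall>(\<phi> :: real^'n \<Rightarrow> real) (grad :: real^'n \<Rightarrow> real^'n) K.
           \<phi> \<in> sobolev_W1 r \<and> has_weak_gradient \<phi> grad \<and>
           (AE x in lebesgue. 0 \<le> \<phi> x) \<and> \<not> (AE x in lebesgue. \<phi> x = 0) \<and>
           integrable lebesgue (\<lambda>x. L (\<phi> x)) \<and> K = (LINT x|lebesgue. L (\<phi> x)) \<longrightarrow>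
           \<phi> \<in> Lq_space q \<and>
           Lq_norm q \<phi> \<le> C * (1 + (1 + K powr \<epsilon>) * K powr \<nu>) * Lq_norm r grad
                            * L ((Lq_norm r grad)\<^sup>2) powr (- \<nu>)"
proof (intro allI impI)
  fix \<epsilon> :: real assume \<epsilon>: "0 < \<epsilon>"
  let ?n = "real CARD('n)"
  \<comment> \<open>For r < n this is a reformulation of the subcriticality of \<open>q\<close>; for
    r \<ge> n the subtracted term is nonpositive.\<close>
  have \<nu>: "0 < \<nu>"
  proof (cases "r < ?n")
    case True
    then have "q * (?n - r) < r * ?n"
      using assms(4) by (simp add: pos_less_divide_eq)
    then show ?thesis using assms(2,3) by (simp add: assms(5) field_simps)
  next
    case False
    then have "(?n - r) / (r * ?n) \<le> 0"
      using assms(2) by (intro divide_nonpos_pos) auto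
    then show ?thesis using assms(3) by (simp add: assms(5) le_less_trans)
  qed
  obtain C1 where C1: "0 < C1"
    and bound: "\<And>(\<phi> :: real^'n \<Rightarrow> real) grad s. \<phi> \<in> sobolev_W1 r \<Longrightarrow> has_weak_gradient \<phi> grad \<Longrightarrow>
      (AE x in lebesgue. 0 \<le> \<phi> x) \<Longrightarrow> integrable lebesgue (\<lambda>x. L (\<phi> x)) \<Longrightarrow>
      0 < (LINT x|lebesgue. L (\<phi> x)) \<Longrightarrow> 0 < s \<Longrightarrow>
      emeasure lebesgue {x. s < \<phi> x} \<le> ennreal ((LINT x|lebesgue. L (\<phi> x)) / L s) \<Longrightarrow>
      \<phi> \<in> Lq_space q \<and>
      Lq_norm q \<phi> \<le> C1 * (s * ((LINT x|lebesgue. L (\<phi> x)) / L s) powr (1 / q)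
        + Lq_norm r grad * ((LINT x|lebesgue. L (\<phi> x)) / L s) powr \<nu>)"
    using sobolev_norm_bound[OF assms] by blast
  obtain C2 where C2: "0 < C2"
    and level: "\<And>G K. 0 < G \<Longrightarrow> 0 < K \<Longrightarrow> \<exists>s>0. s * (K / L s) powr (1 / q) + G * (K / L s) powr \<nu>
        \<le> C2 * (1 + (1 + K powr \<epsilon>) * K powr \<nu>) * G * L (G\<^sup>2) powr (- \<nu>)"
    using optimal_level_bound[OF assms(1,3) \<nu> \<epsilon>] by blast
  have pos: "\<And>s. 0 < s \<Longrightarrow> 0 < L s" and mono: "mono_on {0<..} L"
    using assms(1) unfolding condition_L_def by blast+
  show "\<exists>C>0. \<forall>(\<phi> :: real^'n \<Rightarrow> real) (grad :: real^'n \<Rightarrow> real^'n) K.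
           \<phi> \<in> sobolev_W1 r \<and> has_weak_gradient \<phi> grad \<and>
           (AE x in lebesgue. 0 \<le> \<phi> x) \<and> \<not> (AE x in lebesgue. \<phi> x = 0) \<and>
           integrable lebesgue (\<lambda>x. L (\<phi> x)) \<and> K = (LINT x|lebesgue. L (\<phi> x)) \<longrightarrow>
           \<phi> \<in> Lq_space q \<and>
           Lq_norm q \<phi> \<le> C * (1 + (1 + K powr \<epsilon>) * K powr \<nu>) * Lq_norm r grad
                            * L ((Lq_norm r grad)\<^sup>2) powr (- \<nu>)"
  proof (intro exI[of _ "C1 * C2"] conjI allI impI; (elim conjE)?)
    show "0 < C1 * C2" using C1 C2 by simp
    fix \<phi> :: "real^'n \<Rightarrow> real" and grad K
    assume \<phi>: "\<phi> \<in> sobolev_W1 r" "has_weak_gradient \<phi> grad" and nonneg: "AE x in lebesgue. 0 \<le> \<phi> x"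
      and nz: "\<not> (AE x in lebesgue. \<phi> x = 0)" and int: "integrable lebesgue (\<lambda>x. L (\<phi> x))"
      and K_def: "K = (LINT x|lebesgue. L (\<phi> x))"
    have \<phi>m [measurable]: "\<phi> \<in> borel_measurable lebesgue"
      using \<phi>(1) by (simp add: sobolev_W1_def Lq_space_def)
    have L0: "0 \<le> L 0" by (rule condition_L_zero_nonneg[OF assms(1)])
    have Lnn: "AE x in lebesgue. 0 \<le> L (\<phi> x)"
      using nonneg by eventually_elim (metis L0 less_eq_real_def pos)
    \<comment> \<open>K = 0 would give L(\<phi>) = 0 almost everywhere, which positivity of
      \<open>L\<close> allows only where \<phi> = 0.\<close>
    have K: "0 < K"
    proof (rule ccontr)
      assume "\<not> 0 < K"
      moreover have "0 \<le> K" unfolding K_def by (rule integral_nonneg_AE[OF Lnn])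
      ultimately have "K = 0" by simp
      then have "AE x in lebesgue. L (\<phi> x) = 0"
        using integral_nonneg_eq_0_iff_AE[OF int Lnn] by (simp add: K_def)
      then have "AE x in lebesgue. \<phi> x = 0"
        using nonneg by eventually_elim (metis less_eq_real_def less_irrefl pos)
      then show False using nz by contradiction
    qed
    \<comment> \<open>Chebyshev's inequality for L(\<phi>): by monotonicity L(\<phi>)/L(t) is at
      least 1 on {\<phi> > t}.\<close>
    have em: "emeasure lebesgue {x. t < \<phi> x} \<le> ennreal (K / L t)" if t: "0 < t" for t
    proof -
      have "{x \<in> space lebesgue. t < \<phi> x} \<in> sets lebesgue" by measurable
      then have "emeasure lebesgue {x. t < \<phi> x} = (\<integral>\<^sup>+x. indicator {x. t < \<phi> x} x \<partial>lebesgue)"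
        by simp
      also have "\<dots> \<le> (\<integral>\<^sup>+x. ennreal (L (\<phi> x) / L t) \<partial>lebesgue)"
      proof (rule nn_integral_mono)
        fix x
        have "1 \<le> L (\<phi> x) / L t" if "t < \<phi> x"
          using mono_onD[OF mono, of t "\<phi> x"] that t pos[OF t] by simp
        then show "indicator {x. t < \<phi> x} x \<le> ennreal (L (\<phi> x) / L t)"
          by (auto simp: indicator_def simp flip: ennreal_1 intro!: ennreal_leI)
      qed
      also have "\<dots> = ennreal (LINT x|lebesgue. L (\<phi> x) / L t)"
        using int Lnn pos[OF t] by (intro nn_integral_eq_integral) (auto elim!: eventually_mono)
      finally show ?thesis by (simp add: K_def)
    qed
    have "0 < Lq_norm r grad"
    proof (rule sobolev_gradient_norm_pos[OF \<phi> assms(2) _ nonneg nz])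
      show "emeasure lebesgue {x. t < \<phi> x} < \<infinity>" if "0 < t" for t
        using em[OF that] by (rule le_less_trans) simp
    qed
    then obtain s where s: "0 < s" "s * (K / L s) powr (1 / q) + Lq_norm r grad * (K / L s) powr \<nu>
        \<le> C2 * (1 + (1 + K powr \<epsilon>) * K powr \<nu>) * Lq_norm r grad * L ((Lq_norm r grad)\<^sup>2) powr (- \<nu>)"
      using level K by blast
    have *: "\<phi> \<in> Lq_space q \<and> Lq_norm q \<phi> \<le> C1 * (s * (K / L s) powr (1 / q) + Lq_norm r grad * (K / L s) powr \<nu>)"
      using bound[OF \<phi> nonneg int _ s(1)] K em[OF s(1)] by (simp add: K_def)
    then show "\<phi> \<in> Lq_space q" by simp
    have "Lq_norm q \<phi> \<le> C1 * (C2 * (1 + (1 + K powr \<epsilon>) * K powr \<nu>) * Lq_norm r grad * L ((Lq_norm r grad)\<^sup>2) powr (- \<nu>))"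
      using * s(2) C1 by (meson mult_left_mono less_imp_le order_trans)
    then show "Lq_norm q \<phi> \<le> C1 * C2 * (1 + (1 + K powr \<epsilon>) * K powr \<nu>) * Lq_norm r grad
                            * L ((Lq_norm r grad)\<^sup>2) powr (- \<nu>)"
      by (simp add: mult_ac)
  qed
qed

end
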